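(* Let $m,d\in\mathbb{N}$ with $m\ge d\ge 2$, let $0\le\theta\le\frac{\pi}{2}$, and let $N=m^d$. Let $P_{\Omega^{*}_{|}}$ be the stratified random point set associated with the grid partition $\Omega^{*}_{|}$ of $[0,1]^d$, and let $P_{\Omega^{*}_{\sim}}$ be the stratified random point set associated with the local convex partition $\Omega^{*}_{\sim}$ of $[0,1]^d$ with parameter $\theta$. Then $$\mathbb{E}\big(L_2^2(D_N,P_{\Omega^{*}_{\sim}})\big)\le \mathbb{E}\big(L_2^2(D_N,P_{\Omega^{*}_{|}})\big).$$
   Context: **$L_2$-discrepancy.** For points $t_1,\dots,t_N\in[0,1]^d$ and $P=\{t_1,\dots,t_N\}$, $$L_2(D_N,P)=\Big(\int_{[0,1]^d}\Big|\lambda([0,z))-\frac1N\sum_{i=1}^N\mathbf 1_{[0,z)}(t_i)\Big|^2dz\Big)^{1/2},$$ where $\lambda$ is Lebesgue measure and $[0,z)=\prod_{i=1}^d[0,z_i)$. $L_2^2(D_N,P)$ denotes the square of this quantity. ($D_N$ is only part of the notation.) **Stratified point sets.** For a partition $\Omega=(\Omega_1,\dots,\Omega_N)$ of $[0,1]^d$ (up to null sets) into $N$ sets of volume $1/N$, the stratified random point set $P_\Omega$ consists of $N$ independent random points, the $i$-th one uniformly distributed in $\Omega_i$; $\mathbb{E}$ is expectation with respect to these points. **Grid partition $\Omega^{*}_{|}$.** This is the partition $\Omega^{*}_{|}=(\Omega^{*}_{1,|},\Omega^{*}_{2,|},Q_3,\dots,Q_N)$ of $[0,1]^d$ into the $N=m^d$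 axis-parallel cubes of side $\frac1m$ of the regular grid. The cubes are numbered so that, with $a_1=\frac{m-2}{m}$, $a_i=\frac{m-1}{m}$ for $2\le i\le d$, and $b=\frac1m$, we have $\Omega^{*}_{1,|}=\prod_{i=1}^d[a_i,a_i+b]$ and $\Omega^{*}_{2,|}=[a_1+b,a_1+2b]\times\prod_{i=2}^d[a_i,a_i+b]$. Put $I_d=[a_1,a_1+2b]\times\prod_{i=2}^d[a_i,a_i+b]=\Omega^{*}_{1,|}\cup\Omega^{*}_{2,|}$. **Local convex partition $\Omega^{*}_{\sim}$ with parameter $\theta\in[0,\frac\pi2]$.** This is $\Omega^{*}_{\sim}=(\Omega^{*}_{1,\sim},\Omega^{*}_{2,\sim},Q_3,\dots,Q_N)$, with the same cubes $Q_3,\dots,Q_N$. The cuboid $I_d$ is divided into two convex parts of equal volume by cutting the rectangle $[a_1,a_1+2b]\times[a_2,a_2+b]$ (the first two coordinates) along the line through its center $(a_1+b,a_2+\frac b2)$ that makes angle $\theta$ with the horizontal and slopes downwards (slope $-\tan\theta$; vertical if $\theta=\frac\pi2$). Explicitly, $$\Omega^{*}_{1,\sim}=\{x\in I_d:\ (x_1-a_1-b)\sin\theta+(x_2-a_2-\tfrac b2)\cos\theta\le 0\},$$ and $\Omega^{*}_{2,\sim}$ is the closure of $I_d\setminus\Omega^{*}_{1,\sim}$. For $\theta=\frac\pi2$ this is $\Omega^{*}_{|}$. *)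

theory Defs
  imports "HOL-Probability.Probability"
begin

text \<open>Points of \<open>\<real>\<^sup>d\<close> are functions on \<open>{1..d}\<close>, extended by \<open>undefined\<close> outside, as in
  \<^const>\<open>PiE\<close> and \<^const>\<open>PiM\<close>.\<close>

abbreviation leb :: "nat \<Rightarrow> (nat \<Rightarrow> real) measure" where
  "leb d \<equiv> PiM {1..d} (\<lambda>_. lborel)"

definition unit_cube :: "nat \<Rightarrow> (nat \<Rightarrow> real) set" where
  "unit_cube d = PiE {1..d} (\<lambda>_. {0..1})"

definition anchored_box :: "nat \<Rightarrow> (nat \<Rightarrow> real) \<Rightarrow> (nat \<Rightarrow> real) set" where
  "anchored_box d z = PiE {1..d} (\<lambda>i. {0..<z i})"

definition L2_disc :: "nat \<Rightarrow> nat \<Rightarrow> (nat \<Rightarrow> nat \<Rightarrow> real) \<Rightarrow> real" where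
  "L2_disc d N t = sqrt (LINT z:unit_cube d|leb d.
     \<bar>measure (leb d) (anchored_box d z)
       - 1 / real N * (\<Sum>i=1..N. indicator (anchored_box d z) (t i))\<bar>\<^sup>2)"

text \<open>\<open>X 1, \<dots>, X N\<close> are independent random points on the probability space \<open>M\<close>, and \<open>X i\<close> is
  uniformly distributed in \<open>Q i\<close>.\<close>

definition stratified :: 
  "nat \<Rightarrow> nat \<Rightarrow> (nat \<Rightarrow> (nat \<Rightarrow> real) set) \<Rightarrow> 'a measure \<Rightarrow> (nat \<Rightarrow> 'a \<Rightarrow> nat \<Rightarrow> real) \<Rightarrow> bool" where
  "stratified d N Q M X \<longleftrightarrow>
     prob_space M \<and>
     prob_space.indep_vars M (\<lambda>_. leb d) X {1..N} \<and>
     (\<forall>i\<in>{1..N}. distr M (leb d) (X i) = uniform_measure (leb d) (Q i))"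

definition grid_cubes :: "nat \<Rightarrow> nat \<Rightarrow> (nat \<Rightarrow> real) set set" where
  "grid_cubes d m =
     (\<lambda>k. PiE {1..d} (\<lambda>i. {real (k i) / real m .. (real (k i) + 1) / real m})) 
       ` (PiE {1..d} (\<lambda>_. {0..<m}))"

definition corner :: "nat \<Rightarrow> nat \<Rightarrow> real" where
  "corner m i = (if i = 1 then (real m - 2) / real m else (real m - 1) / real m)"

definition side :: "nat \<Rightarrow> real" where
  "side m = 1 / real m"

definition grid1 :: "nat \<Rightarrow> nat \<Rightarrow> (nat \<Rightarrow> real) set" where
  "grid1 d m = PiE {1..d} (\<lambda>i. {corner m i .. corner m i + side m})"

definition grid2 :: "nat \<Rightarrow> nat \<Rightarrow> (nat \<Rightarrow> real) set" where
  "grid2 d m = PiE {1..d} (\<lambda>i. if i = 1 then {corner m 1 + side m .. corner m 1 + 2 * side m}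
                                else {corner m i .. corner m i + side m})"

definition cuboid :: "nat \<Rightarrow> nat \<Rightarrow> (nat \<Rightarrow> real) set" where
  "cuboid d m = PiE {1..d} (\<lambda>i. if i = 1 then {corner m 1 .. corner m 1 + 2 * side m}
                                else {corner m i .. corner m i + side m})"

text \<open>The numbering of the remaining cubes is arbitrary, so the grid partition is any enumeration
  of the cubes with the prescribed first two members.\<close>

definition grid_partition :: "nat \<Rightarrow> nat \<Rightarrow> (nat \<Rightarrow> (nat \<Rightarrow> real) set) \<Rightarrow> bool" where
  "grid_partition d m Q \<longleftrightarrow>
     bij_betw Q {1..m ^ d} (grid_cubes d m) \<and> Q 1 = grid1 d m \<and> Q 2 = grid2 d m"

definition local1 :: "nat \<Rightarrow> nat \<Rightarrow> real \<Rightarrow> (nat \<Rightarrow> real) set" where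
  "local1 d m \<theta> = {x \<in> cuboid d m.
     (x 1 - corner m 1 - side m) * sin \<theta> + (x 2 - corner m 2 - side m / 2) * cos \<theta> \<le> 0}"

text \<open>The closure is taken in the product topology on \<^typ>\<open>nat \<Rightarrow> real\<close>. Since all points of the cuboid
  take the same value outside \<open>{1..d}\<close>, it is the Euclidean closure in the first \<open>d\<close> coordinates.\<close>

definition local2 :: "nat \<Rightarrow> nat \<Rightarrow> real \<Rightarrow> (nat \<Rightarrow> real) set" where
  "local2 d m \<theta> = closure (cuboid d m - local1 d m \<theta>)"

definition local_partition ::
  "nat \<Rightarrow> nat \<Rightarrow> real \<Rightarrow> (nat \<Rightarrow> (nat \<Rightarrow> real) set) \<Rightarrow> nat \<Rightarrow> (nat \<Rightarrow> real) set" where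
  "local_partition d m \<theta> Q = Q(1 := local1 d m \<theta>, 2 := local2 d m \<theta>)"

end

theory Submission
  imports Defs
begin

text \<open>
  For a stratified sample, the error at a fixed \<open>z\<close> has mean square bias squared plus variance. With
  \<open>p\<^sub>i z\<close> the share of the \<open>i\<close>-th set that lies in the box \<open>[0, z)\<close>, the bias depends on the sum of
  the \<open>p\<^sub>i\<close> only, and the variance is \<open>1/N\<^sup>2\<close> times the sum of \<open>p\<^sub>i - p\<^sub>i\<^sup>2\<close>. Re-cutting the cuboid
  formed by the first two cubes changes neither \<open>p\<^sub>1 + p\<^sub>2\<close> nor any other \<open>p\<^sub>i\<close>, so only
  \<open>p\<^sub>1\<^sup>2 + p\<^sub>2\<^sup>2 = ((p\<^sub>1 + p\<^sub>2)\<^sup>2 + (p\<^sub>1 - p\<^sub>2)\<^sup>2) / 2\<close> matters (\<open>mean_square_error_eq\<close>). Hence the claim is that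
  the \<open>L\<^sub>2\<close> norm over \<open>z\<close> of the imbalance \<open>p\<^sub>1 - p\<^sub>2\<close> is minimal for the vertical cut.

  The cuboid sits in the upper corner of the unit cube. In coordinates rescaled to \<open>[-1, 1]\<close> every
  admissible cut is \<open>{x. x\<^sub>p \<le> - t x\<^sub>q}\<close> with \<open>{p, q} = {1, 2}\<close> and \<open>0 \<le> t \<le> 1\<close>: take \<open>p = 1\<close> for a steep
  line and \<open>p = 2\<close> for a flat one (\<open>local_partition_cuts\<close>). The straight cut \<open>t = 0\<close> has, up to a constant
  factor, the imbalance
  \<open>h z = (1 - \<bar>z\<^sub>p\<bar>) * \<Prod>j\<noteq>p. (1 + z\<^sub>j)\<close>, on the cuboid, which is nonnegative and whose norm is the same for \<open>p = 1\<close> and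
  \<open>p = 2\<close> (\<open>integral_imbalance_square_straight\<close>). So it suffices to compare a slanted cut with the
  straight cut in its own direction \<open>p\<close>.

  Let \<open>F\<close> be the imbalance of the slanted cut. From \<open>F\<^sup>2 \<ge> h\<^sup>2 + 2 h (F - h)\<close> it is enough that
  \<open>\<integral> h F \<ge> \<integral> h\<^sup>2\<close>, which is linear in \<open>F\<close> (\<open>integral_imbalance_square_ge_straight\<close>). By Fubini,
  \<open>\<integral> h F\<close> is governed by the integral over the first part of the cut of the product of the
  one-dimensional tails of \<open>h\<close>. All coordinates but \<open>p\<close> and \<open>q\<close> split off as constant factors, and what
  remains is an explicit one-dimensional integral, which exceeds its value at \<open>t = 0\<close> by at least
  \<open>t/3 - 2t\<^sup>2/5 + 8t\<^sup>4/105 \<ge> 0\<close> (\<open>tail_integral_slanted_ge_straight\<close>).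
\<close>

(* Keeps the index set {1..d} from being rewritten to {Suc 0..d}. *)
declare One_nat_def [simp del]

section \<open>Mean square error of stratified samples\<close>

text \<open>
  Bias-variance decomposition: centring the summands makes the cross terms vanish by independence,
  and a variable with values \<open>0\<close> and \<open>1\<close> equals its own square.
\<close>

lemma (in prob_space) expectation_square_affine_indep_sum:
  fixes Y :: "'i \<Rightarrow> 'a \<Rightarrow> real"
  assumes fin: "finite I" and ind: "indep_vars (\<lambda>_. borel) Y I"
    and Y01: "\<And>i \<omega>. i \<in> I \<Longrightarrow> Y i \<omega> \<in> {0, 1}"
  shows "expectation (\<lambda>\<omega>. (c - a * (\<Sum>i\<in>I. Y i \<omega>))\<^sup>2)
       = (c - a * (\<Sum>i\<in>I. expectation (Y i)))\<^sup>2
         + a\<^sup>2 * (\<Sum>i\<in>I. expectation (Y i) - (expectation (Y i))\<^sup>2)"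
proof -
  define \<mu> where "\<mu> i = expectation (Y i)" for i
  define Z where "Z i \<omega> = Y i \<omega> - \<mu> i" for i \<omega>
  have rv[measurable]: "random_variable borel (Y i)" if "i \<in> I" for i
    using ind that by (auto simp: indep_vars_def)
  have bnd: "\<bar>Y i \<omega>\<bar> \<le> 1" if "i \<in> I" for i \<omega>
    using Y01[OF that, of \<omega>] by auto
  have int: "integrable M (Y i)" if "i \<in> I" for i
    by (rule integrable_const_bound[where B=1]) (use that bnd in auto)
  have intZ: "integrable M (Z i)" if "i \<in> I" for i
    unfolding Z_def using int[OF that] by simp
  have Z0: "expectation (Z i) = 0" if "i \<in> I" for i
    unfolding Z_def using int[OF that] by (simp add: \<mu>_def prob_space)
  have sq: "(Y i \<omega>)\<^sup>2 = Y i \<omega>" if "i \<in> I" for i \<omega>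
    using Y01[OF that, of \<omega>] by auto
  have ZZ: "integrable M (\<lambda>\<omega>. Z i \<omega> * Z j \<omega>) \<and>
      expectation (\<lambda>\<omega>. Z i \<omega> * Z j \<omega>) = (if i = j then \<mu> i - (\<mu> i)\<^sup>2 else 0)"
    if ij: "i \<in> I" "j \<in> I" for i j
  proof (cases "i = j")
    case True
    have eq: "(\<lambda>\<omega>. Z i \<omega> * Z i \<omega>) = (\<lambda>\<omega>. (1 - 2 * \<mu> i) * Y i \<omega> + (\<mu> i)\<^sup>2)"
      using sq[OF ij(1)] by (auto simp: Z_def fun_eq_iff algebra_simps power2_eq_square)
    show ?thesis
      unfolding True[symmetric] eq using int[OF ij(1)]
      by (simp add: prob_space \<mu>_def[symmetric] algebra_simps power2_eq_square)
  next
    case False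
    have "indep_var borel (Y i) borel (Y j)"
    proof -
      have "indep_vars (\<lambda>_. borel) Y {i, j}"
        by (rule indep_vars_subset[OF ind]) (use ij in auto)
      from indep_vars_sum[of "{j}" i Y] this False show ?thesis by simp
    qed
    then have "indep_var borel ((\<lambda>y. y - \<mu> i) \<circ> Y i) borel ((\<lambda>y. y - \<mu> j) \<circ> Y j)"
      by (rule indep_var_compose) auto
    then have "indep_var borel (Z i) borel (Z j)"
      by (simp add: Z_def[abs_def] comp_def)
    from indep_var_lebesgue_integral[OF this] indep_var_integrable[OF this]
    show ?thesis using intZ Z0 ij False by simp
  qed
  \<comment> \<open>The bias, which is deterministic.\<close>
  define e where "e = c - a * (\<Sum>i\<in>I. \<mu> i)"
  have "expectation (\<lambda>\<omega>. (c - a * (\<Sum>i\<in>I. Y i \<omega>))\<^sup>2)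
      = expectation (\<lambda>\<omega>. (e\<^sup>2 - 2 * e * a * (\<Sum>i\<in>I. Z i \<omega>)) + a\<^sup>2 * (\<Sum>i\<in>I. \<Sum>j\<in>I. Z i \<omega> * Z j \<omega>))"
  proof (rule Bochner_Integration.integral_cong[OF refl])
    fix \<omega>
    have "(\<Sum>i\<in>I. \<Sum>j\<in>I. Z i \<omega> * Z j \<omega>) = (\<Sum>i\<in>I. Z i \<omega>)\<^sup>2"
      by (simp add: sum_product power2_eq_square)
    moreover have "(\<Sum>i\<in>I. Y i \<omega>) = (\<Sum>i\<in>I. Z i \<omega>) + (\<Sum>i\<in>I. \<mu> i)"
      by (simp add: Z_def sum_subtractf)
    ultimately show "(c - a * (\<Sum>i\<in>I. Y i \<omega>))\<^sup>2 = (e\<^sup>2 - 2 * e * a * (\<Sum>i\<in>I. Z i \<omega>))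
        + a\<^sup>2 * (\<Sum>i\<in>I. \<Sum>j\<in>I. Z i \<omega> * Z j \<omega>)"
      by (simp add: e_def algebra_simps power2_eq_square)
  qed
  also have "\<dots> = (e\<^sup>2 - 2 * e * a * (\<Sum>i\<in>I. expectation (Z i)))
      + a\<^sup>2 * (\<Sum>i\<in>I. \<Sum>j\<in>I. expectation (\<lambda>\<omega>. Z i \<omega> * Z j \<omega>))"
    using intZ ZZ by (simp add: prob_space)
  also have "\<dots> = e\<^sup>2 + a\<^sup>2 * (\<Sum>i\<in>I. \<mu> i - (\<mu> i)\<^sup>2)"
    using Z0 ZZ fin by simp
  finally show ?thesis unfolding e_def \<mu>_def .
qed

interpretation leb: product_sigma_finite "\<lambda>_::nat. lborel :: real measure"
  by standard

lemma sigma_finite_leb: "sigma_finite_measure (leb d)"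
  by (rule leb.sigma_finite) simp

lemma mem_anchored_box:
  assumes "x \<in> space (leb d)"
  shows "x \<in> anchored_box d z \<longleftrightarrow> (\<forall>j\<in>{1..d}. 0 \<le> x j \<and> x j < z j)"
  using assms by (auto simp: anchored_box_def space_PiM PiE_iff)

text \<open>
  Joint measurability in the point and in the corner of the box, which is what Fubini needs.
\<close>

lemma measurable_mem_anchored_box:
  "Measurable.pred (leb d \<Otimes>\<^sub>M leb d) (\<lambda>w. fst w \<in> anchored_box d (snd w))"
proof -
  have "Measurable.pred (leb d \<Otimes>\<^sub>M leb d) (\<lambda>w. \<forall>j\<in>{1..d}. 0 \<le> fst w j \<and> fst w j < snd w j)"
    by measurable
  then show ?thesis
    by (rule measurable_cong[THEN iffD2, rotated]) (auto simp: mem_anchored_box space_pair_measure)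
qed

lemma sets_anchored_box [measurable]: "anchored_box d z \<in> sets (leb d)"
  unfolding anchored_box_def by (intro sets_PiM_I_finite) auto

lemma sets_unit_cube [measurable]: "unit_cube d \<in> sets (leb d)"
  unfolding unit_cube_def by (intro sets_PiM_I_finite) auto

lemma emeasure_unit_cube: "emeasure (leb d) (unit_cube d) = 1"
  unfolding unit_cube_def by (subst leb.emeasure_PiM) auto

abbreviation ucube :: "nat \<Rightarrow> (nat \<Rightarrow> real) measure" where
  "ucube d \<equiv> restrict_space (leb d) (unit_cube d)"

lemma prob_space_ucube: "prob_space (ucube d)"
  by (rule prob_spaceI)
     (simp add: emeasure_restrict_space space_restrict_space emeasure_unit_cube
       sets.sets_into_space[OF sets_unit_cube] Int_absorb2)

lemma space_ucube: "space (ucube d) = unit_cube d"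
  using sets.sets_into_space[OF sets_unit_cube[of d]] by (simp add: space_restrict_space Int_absorb2)

lemma set_integral_unit_cube:
  fixes f :: "(nat \<Rightarrow> real) \<Rightarrow> real"
  shows "(LINT z:unit_cube d|leb d. f z) = (LINT z|ucube d. f z)"
  by (simp add: set_lebesgue_integral_def integral_restrict_space)

lemma measurable_measure_anchored_box:
  assumes sf: "sigma_finite_measure P" and sets_P: "sets P = sets (leb d)"
  shows "(\<lambda>z. measure P (anchored_box d z)) \<in> borel_measurable (leb d)"
proof -
  interpret sigma_finite_measure P by fact
  have [measurable_cong]: "sets P = sets (leb d)" by fact
  have "{w \<in> space (leb d \<Otimes>\<^sub>M P). snd w \<in> anchored_box d (fst w)} \<in> sets (leb d \<Otimes>\<^sub>M P)"
  proof -
    have "Measurable.pred (leb d \<Otimes>\<^sub>M P) ((\<lambda>w. fst w \<in> anchored_box d (snd w)) \<circ> (\<lambda>w. (snd w, fst w)))"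
      by (rule measurable_comp[OF _ measurable_mem_anchored_box]) measurable
    then show ?thesis by (simp add: comp_def pred_def)
  qed
  moreover have "anchored_box d z = Pair z -` {w \<in> space (leb d \<Otimes>\<^sub>M P). snd w \<in> anchored_box d (fst w)}" 
    if "z \<in> space (leb d)" for z
    using sets.sets_into_space[OF sets_anchored_box, of d z] that sets_eq_imp_space_eq[OF sets_P]
    by (auto simp: space_pair_measure)
  moreover note measurable_emeasure_Pair[OF calculation(1)]
  ultimately have "(\<lambda>z. emeasure P (anchored_box d z)) \<in> borel_measurable (leb d)"
    by (subst measurable_cong) auto
  then show ?thesis unfolding measure_def by measurable
qed

definition hit_prob :: "nat \<Rightarrow> (nat \<Rightarrow> real) set \<Rightarrow> (nat \<Rightarrow> real) \<Rightarrow> real" where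
  "hit_prob d A z = measure (uniform_measure (leb d) A) (anchored_box d z)"

text \<open>
  Squared bias plus variance of the local discrepancy at \<open>z\<close>.
\<close>

definition mean_square_error :: "nat \<Rightarrow> nat \<Rightarrow> (nat \<Rightarrow> (nat \<Rightarrow> real) set) \<Rightarrow> (nat \<Rightarrow> real) \<Rightarrow> real" where
  "mean_square_error d N Q z =
     (measure (leb d) (anchored_box d z) - 1 / real N * (\<Sum>i=1..N. hit_prob d (Q i) z))\<^sup>2
     + (1 / real N)\<^sup>2 * (\<Sum>i=1..N. hit_prob d (Q i) z - (hit_prob d (Q i) z)\<^sup>2)"

text \<open>
  The local discrepancy is bounded by \<open>2\<close>, so expectation and integration over \<open>z\<close> may be exchanged;
  the decomposition above then applies for each \<open>z\<close> separately.
\<close>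

lemma
  assumes "stratified d N Q M X"
  shows expectation_L2_disc: "prob_space.expectation M (\<lambda>\<omega>. (L2_disc d N (\<lambda>i. X i \<omega>))\<^sup>2)
           = (LINT z|ucube d. mean_square_error d N Q z)"
    and integrable_mean_square_error: "integrable (ucube d) (mean_square_error d N Q)"
proof -
  interpret prob_space M using assms by (simp add: stratified_def)
  interpret U: prob_space "ucube d" by (rule prob_space_ucube)
  interpret MU: pair_prob_space M "ucube d" ..
  have ind: "indep_vars (\<lambda>_. leb d) X {1..N}"
    and dist: "\<And>i. i \<in> {1..N} \<Longrightarrow> distr M (leb d) (X i) = uniform_measure (leb d) (Q i)"
    using assms by (auto simp: stratified_def)
  have rv[measurable]: "X i \<in> measurable M (leb d)" if "i \<in> {1..N}" for i
    using ind that by (auto simp: indep_vars_def)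
  define Y where "Y z i \<omega> = (indicator (anchored_box d z) (X i \<omega>) :: real)" for z i \<omega>
  have EY: "expectation (Y z i) = hit_prob d (Q i) z"
    if "i \<in> {1..N}" for z i
  proof -
    have "expectation (Y z i) = (\<integral>x. indicator (anchored_box d z) x \<partial>distr M (leb d) (X i))"
      unfolding Y_def using that by (subst integral_distr) auto
    also have "\<dots> = hit_prob d (Q i) z"
      unfolding dist[OF that] hit_prob_def
      by (simp add: sets.sets_into_space[OF sets_anchored_box, unfolded space_PiM] Int_absorb2)
    finally show ?thesis .
  qed
  have indY: "indep_vars (\<lambda>_. borel) (Y z) {1..N}" for z
    unfolding Y_def by (rule indep_vars_compose2[OF ind]) measurable
  define F where "F \<omega> z = (measure (leb d) (anchored_box d z) - 1 / real N * (\<Sum>i=1..N. Y z i \<omega>))\<^sup>2" for \<omega> z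
  have mU: "(\<lambda>z. measure (leb d) (anchored_box d z)) \<in> borel_measurable (ucube d)"
    by (intro measurable_restrict_space1 measurable_measure_anchored_box sigma_finite_leb) simp
  have mY: "(\<lambda>w. Y (snd w) i (fst w)) \<in> borel_measurable (M \<Otimes>\<^sub>M ucube d)" if "i \<in> {1..N}" for i
  proof -
    have 1: "snd \<in> measurable (M \<Otimes>\<^sub>M ucube d) (leb d)"
      by (rule measurable_compose[OF measurable_snd]) (simp add: measurable_restrict_space1)
    have "(\<lambda>w. (X i (fst w), snd w)) \<in> measurable (M \<Otimes>\<^sub>M ucube d) (leb d \<Otimes>\<^sub>M leb d)"
      using rv[OF that] 1 by measurable
    from measurable_comp[OF this measurable_mem_anchored_box]
    have "Measurable.pred (M \<Otimes>\<^sub>M ucube d) (\<lambda>w. X i (fst w) \<in> anchored_box d (snd w))"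
      by (simp add: comp_def)
    then have "(\<lambda>w. if X i (fst w) \<in> anchored_box d (snd w) then 1 else 0 :: real)
      \<in> borel_measurable (M \<Otimes>\<^sub>M ucube d)" by measurable
    then show ?thesis by (simp add: Y_def indicator_def of_bool_def)
  qed
  have Fm: "(\<lambda>w. F (fst w) (snd w)) \<in> borel_measurable (M \<Otimes>\<^sub>M ucube d)"
    unfolding F_def using mY measurable_compose[OF measurable_snd mU] by measurable
  have box1: "measure (leb d) (anchored_box d z) \<le> 1" if "z \<in> unit_cube d" for z
  proof -
    have "anchored_box d z \<subseteq> unit_cube d"
      using that by (force simp: anchored_box_def unit_cube_def PiE_iff)
    then have "measure (leb d) (anchored_box d z) \<le> measure (leb d) (unit_cube d)"
      by (intro measure_mono_fmeasurable) (auto simp: fmeasurable_def emeasure_unit_cube)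
    then show ?thesis by (simp add: measure_def emeasure_unit_cube)
  qed
  have Fb: "\<bar>F \<omega> z\<bar> \<le> 4" if "z \<in> unit_cube d" for \<omega> z
  proof -
    have "(\<Sum>i=1..N. Y z i \<omega>) \<le> (\<Sum>i=1..N. 1)" "0 \<le> (\<Sum>i=1..N. Y z i \<omega>)"
      by (intro sum_mono sum_nonneg; simp add: Y_def indicator_def)+
    then have "\<bar>1 / real N * (\<Sum>i=1..N. Y z i \<omega>)\<bar> \<le> 1"
      by (cases "N = 0") (auto simp: field_simps)
    with box1[OF that] have "\<bar>measure (leb d) (anchored_box d z) - 1 / real N * (\<Sum>i=1..N. Y z i \<omega>)\<bar> \<le> 2"
      using measure_nonneg[of "leb d" "anchored_box d z"] by linarith
    then show ?thesis using power2_le_iff_abs_le[of 2 "measure (leb d) (anchored_box d z) - 1 / real N * (\<Sum>i=1..N. Y z i \<omega>)"]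
      by (simp add: F_def)
  qed
  have Fi: "integrable (M \<Otimes>\<^sub>M ucube d) (\<lambda>(\<omega>, z). F \<omega> z)"
    by (rule MU.P.integrable_const_bound[where B=4])
       (use Fb Fm space_ucube in \<open>auto simp: space_pair_measure split_beta'\<close>)
  have EF: "(LINT \<omega>|M. F \<omega> z) = mean_square_error d N Q z" for z
  proof -
    have "(LINT \<omega>|M. F \<omega> z) = (measure (leb d) (anchored_box d z) - 1 / real N * (\<Sum>i=1..N. expectation (Y z i)))\<^sup>2
      + (1 / real N)\<^sup>2 * (\<Sum>i=1..N. expectation (Y z i) - (expectation (Y z i))\<^sup>2)"
      unfolding F_def by (rule expectation_square_affine_indep_sum[OF _ indY]) (auto simp: Y_def indicator_def)
    also have "(\<Sum>i=1..N. expectation (Y z i)) = (\<Sum>i=1..N. hit_prob d (Q i) z)"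
      by (intro sum.cong refl EY)
    also have "(\<Sum>i=1..N. expectation (Y z i) - (expectation (Y z i))\<^sup>2)
        = (\<Sum>i=1..N. hit_prob d (Q i) z - (hit_prob d (Q i) z)\<^sup>2)"
      by (intro sum.cong refl) (simp only: EY)
    finally show ?thesis unfolding mean_square_error_def .
  qed
  have "(L2_disc d N (\<lambda>i. X i \<omega>))\<^sup>2 = (LINT z|ucube d. F \<omega> z)" for \<omega>
    unfolding L2_disc_def set_integral_unit_cube F_def Y_def
    by (subst real_sqrt_pow2) (auto intro!: integral_nonneg_AE)
  then have "expectation (\<lambda>\<omega>. (L2_disc d N (\<lambda>i. X i \<omega>))\<^sup>2) = (LINT \<omega>|M. LINT z|ucube d. F \<omega> z)"
    by simp
  also have "\<dots> = (LINT z|ucube d. LINT \<omega>|M. F \<omega> z)"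
    by (rule MU.Fubini_integral[symmetric]) (rule Fi)
  finally show "expectation (\<lambda>\<omega>. (L2_disc d N (\<lambda>i. X i \<omega>))\<^sup>2) = (LINT z|ucube d. mean_square_error d N Q z)"
    by (simp only: EF)
  show "integrable (ucube d) (mean_square_error d N Q)"
    using MU.integrable_snd[OF Fi] by (simp only: EF)
qed

section \<open>One-dimensional profiles\<close>

text \<open>
  The affine map that takes \<open>[1 - 2\<rho>, 1]\<close> onto \<open>[-1, 1]\<close>; \<open>\<rho>\<close> is the half length of an edge.
\<close>

definition rel_coord :: "real \<Rightarrow> real \<Rightarrow> real" where
  "rel_coord \<rho> x = (x - 1) / \<rho> + 1"

lemma rel_coord_measurable [measurable]: "rel_coord \<rho> \<in> borel_measurable borel"
  unfolding rel_coord_def by measurable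

lemma nn_integral_rel_coord:
  assumes [measurable]: "f \<in> borel_measurable borel" and "0 < \<rho>"
  shows "(\<integral>\<^sup>+x. f (rel_coord \<rho> x) \<partial>lborel) = ennreal \<rho> * (\<integral>\<^sup>+x. f x \<partial>lborel)"
proof -
  have "(\<integral>\<^sup>+x. f (rel_coord \<rho> x) \<partial>lborel) = \<bar>\<rho>\<bar> * (\<integral>\<^sup>+x. f (rel_coord \<rho> ((1 - \<rho>) + \<rho> * x)) \<partial>lborel)"
    using assms(2) by (intro nn_integral_real_affine) auto
  also have "(\<lambda>x. rel_coord \<rho> ((1 - \<rho>) + \<rho> * x)) = (\<lambda>x. x)"
    using assms(2) by (auto simp: rel_coord_def field_simps)
  finally show ?thesis using assms(2) by (simp add: fun_eq_iff)
qed

lemma rel_coord_bounds: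
  assumes "0 < \<rho>"
  shows "rel_coord \<rho> x \<le> 1 \<longleftrightarrow> x \<le> 1" "-1 \<le> rel_coord \<rho> x \<longleftrightarrow> 1 - 2 * \<rho> \<le> x" "rel_coord \<rho> x \<le> 0 \<longleftrightarrow> x \<le> 1 - \<rho>"
    "rel_coord \<rho> x < rel_coord \<rho> y \<longleftrightarrow> x < y"
  using assms by (auto simp: rel_coord_def field_simps)

text \<open>
  The one-dimensional factors of the imbalance of a straight cut, in rescaled coordinates. The flag
  marks the direction across which the cut is made: there the length below \<open>s\<close> is counted positively up
  to \<open>0\<close> and negatively beyond it, while in the other directions it is counted positively throughout.
\<close>

definition profile :: "bool \<Rightarrow> real \<Rightarrow> real" where
  "profile b s = (if b then max 0 (1 - \<bar>s\<bar>) else max 0 (1 + s))"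

text \<open>
  On \<open>[-1, 1]\<close> this is the integral of the profile over \<open>[s, 1]\<close>.
\<close>

definition tail :: "bool \<Rightarrow> real \<Rightarrow> real" where
  "tail b s = (if b then 1/2 - s + s * \<bar>s\<bar> / 2 else 3/2 - s - s\<^sup>2 / 2)"

text \<open>
  A primitive of \<open>tail True\<close>.
\<close>

definition tail_primitive :: "real \<Rightarrow> real" where
  "tail_primitive u = u / 2 - u\<^sup>2 / 2 + \<bar>u\<bar> ^ 3 / 6"

lemma profile_nonneg [simp]: "0 \<le> profile b s" by (simp add: profile_def)
lemma profile_measurable [measurable]: "profile b \<in> borel_measurable borel" unfolding profile_def by measurable
lemma tail_measurable [measurable]: "tail b \<in> borel_measurable borel" unfolding tail_def by measurable
lemma tail_primitive_measurable [measurable]: "tail_primitive \<in> borel_measurable borel" unfolding tail_primitive_def by measurable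

lemma DERIV_mult_abs: "((\<lambda>x::real. x * \<bar>x\<bar>) has_real_derivative 2 * \<bar>x\<bar>) (at x)"
proof (cases "x = 0")
  case True
  show ?thesis
    unfolding True has_field_derivative_iff
  proof (rule Lim_transform_eventually)
    show "((\<lambda>x::real. \<bar>x\<bar>) \<longlongrightarrow> 2 * \<bar>0\<bar>) (at 0)"
      by (auto intro!: tendsto_eq_intros)
  next
    show "\<forall>\<^sub>F x::real in at 0. \<bar>x\<bar> = (x * \<bar>x\<bar> - 0 * \<bar>0\<bar>) / (x - 0)"
      by (auto simp: eventually_at_filter)
  qed
next
  case False
  then consider "x > 0" | "x < 0" by linarith
  then show ?thesis
  proof cases
    case 1
    have "((\<lambda>x. x * x) has_real_derivative 2 * \<bar>x\<bar>) (at x)"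
      using 1 by (auto intro!: derivative_eq_intros)
    then show ?thesis
      by (rule has_field_derivative_transform_within_open[where S = "{0<..}"]) (use 1 in auto)
  next
    case 2
    have "((\<lambda>x. - (x * x)) has_real_derivative 2 * \<bar>x\<bar>) (at x)"
      using 2 by (auto intro!: derivative_eq_intros)
    then show ?thesis
      by (rule has_field_derivative_transform_within_open[where S = "{..<0}"]) (use 2 in auto)
  qed
qed

lemma DERIV_abs_cube: "((\<lambda>x::real. \<bar>x\<bar> ^ 3) has_real_derivative 3 * (x * \<bar>x\<bar>)) (at x)"
proof -
  have "\<bar>x\<bar> ^ 3 = x * (x * \<bar>x\<bar>)" for x :: real
    by (simp add: power3_eq_cube abs_mult_self_eq mult.assoc[symmetric])
  moreover have "((\<lambda>x. x * (x * \<bar>x\<bar>)) has_real_derivative 3 * (x * \<bar>x\<bar>)) (at x)"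
    by (rule derivative_eq_intros DERIV_mult_abs refl)+ simp
  ultimately show ?thesis by simp
qed

lemma tail_nonneg:
  assumes "s \<in> {-1..1}"
  shows "0 \<le> tail b s"
proof -
  have "s * \<bar>s\<bar> \<ge> 2 * s - 1"
  proof (cases "s \<ge> 0")
    case True
    then show ?thesis using zero_le_power2[of "s - 1"] by (simp add: power2_eq_square algebra_simps)
  next
    case False
    then have "s * s \<le> 1 * -s" using assms mult_right_mono[of "-s" 1 "-s"] by simp
    then show ?thesis using False assms by simp
  qed
  moreover have "(1 - s) * (3 + s) \<ge> 0" using assms by (intro mult_nonneg_nonneg) auto
  ultimately show ?thesis by (auto simp: tail_def algebra_simps power2_eq_square)
qed

lemma nn_integral_profile_above:
  assumes s: "s \<in> {-1..1}"
  shows "(\<integral>\<^sup>+y. ennreal (profile b y) * indicator {s<..1} y \<partial>lborel) = ennreal (tail b s)"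
proof -
  have "(\<integral>\<^sup>+y. ennreal (profile b y) * indicator {s<..1} y \<partial>lborel) 
      = (\<integral>\<^sup>+y. ennreal (profile b y) * indicator {s..1} y \<partial>lborel)"
    by (rule nn_integral_cong_AE) (use AE_lborel_singleton[of s] in eventually_elim, auto simp: indicator_def)
  also have "\<dots> = ennreal ((if b then 1 - 1 * \<bar>1\<bar> / 2 else 1 + 1\<^sup>2 / 2) - (if b then s - s * \<bar>s\<bar> / 2 else s + s\<^sup>2 / 2))"
  proof (cases b)
    case True
    have "(\<integral>\<^sup>+y. ennreal (profile b y) * indicator {s..1} y \<partial>lborel) = ennreal ((1 - 1 * \<bar>1\<bar> / 2) - (s - s * \<bar>s\<bar> / 2))"
    proof (rule nn_integral_FTC_Icc[where F = "\<lambda>s. s - s * \<bar>s\<bar> / 2"])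
      fix x assume "x \<in> {s..1}"
      with s True have "profile b x = 1 - \<bar>x\<bar>" by (auto simp: profile_def)
      then show "((\<lambda>s. s - s * \<bar>s\<bar> / 2) has_real_derivative profile b x) (at x)"
        using DERIV_diff[OF DERIV_ident DERIV_cdivide[OF DERIV_mult_abs, of 2]]
        by simp
    qed (use s in auto)
    then show ?thesis using True by simp
  next
    case False
    have "(\<integral>\<^sup>+y. ennreal (profile b y) * indicator {s..1} y \<partial>lborel) = ennreal ((1 + 1\<^sup>2 / 2) - (s + s\<^sup>2 / 2))"
    proof (rule nn_integral_FTC_Icc[where F = "\<lambda>s. s + s\<^sup>2 / 2"])
      fix x assume "x \<in> {s..1}"
      with s False have "profile b x = 1 + x" by (auto simp: profile_def)
      then show "((\<lambda>s. s + s\<^sup>2 / 2) has_real_derivative profile b x) (at x)"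
        by (auto intro!: derivative_eq_intros)
    qed (use s in auto)
    then show ?thesis using False by simp
  qed
  also have "\<dots> = ennreal (tail b s)"
    by (rule arg_cong[where f = ennreal]) (cases b; simp add: tail_def field_simps)
  finally show ?thesis .
qed

text \<open>
  The values do not depend on which coordinate carries the flag, so a product of such factors with
  exactly one flag set has the same norm for every choice of the flagged coordinate.
\<close>

lemma nn_integral_profile_square:
  "(\<integral>\<^sup>+y. ennreal ((profile b y)\<^sup>2) * indicator {-1..1} y \<partial>lborel) = ennreal (if b then 2/3 else 8/3)"
proof (cases b)
  case True
  have "(\<integral>\<^sup>+y. ennreal ((profile b y)\<^sup>2) * indicator {-1..1} y \<partial>lborel)
     = ennreal ((1 - 1 * \<bar>1\<bar> + 1^3/3) - ((-1) - (-1) * \<bar>-1\<bar> + (-1)^3/3))"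
  proof (rule nn_integral_FTC_Icc[where F = "\<lambda>s. s - s * \<bar>s\<bar> + s^3/3"])
    fix x :: real assume "x \<in> {-1..1}"
    with True have "(profile b x)\<^sup>2 = 1 - 2 * \<bar>x\<bar> + x\<^sup>2" by (auto simp: profile_def power2_diff)
    then show "((\<lambda>s. s - s * \<bar>s\<bar> + s^3/3) has_real_derivative (profile b x)\<^sup>2) (at x)"
    proof -
      have "((\<lambda>s::real. s^3/3) has_real_derivative x\<^sup>2) (at x)"
        by (auto intro!: derivative_eq_intros)
      from DERIV_add[OF DERIV_diff[OF DERIV_ident DERIV_mult_abs] this]
      show ?thesis using \<open>(profile b x)\<^sup>2 = _\<close>
        by simp
    qed
  qed auto
  then show ?thesis using True by simp
next
  case False
  have "(\<integral>\<^sup>+y. ennreal ((profile b y)\<^sup>2) * indicator {-1..1} y \<partial>lborel)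
     = ennreal ((1 + 1)^3/3 - (1 + (-1))^3/3)"
  proof (rule nn_integral_FTC_Icc[where F = "\<lambda>s. (1 + s)^3/3"])
    fix x :: real assume "x \<in> {-1..1}"
    with False have "(profile b x)\<^sup>2 = (1 + x)\<^sup>2" by (auto simp: profile_def)
    then show "((\<lambda>s. (1 + s)^3/3) has_real_derivative (profile b x)\<^sup>2) (at x)"
      by (auto intro!: derivative_eq_intros)
  qed auto
  then show ?thesis using False by simp
qed

lemma nn_integral_tail_initial:
  assumes a: "a \<in> {-1..1}"
  shows "(\<integral>\<^sup>+u. ennreal (tail True u) * indicator {-1..a} u \<partial>lborel) = ennreal (tail_primitive a - tail_primitive (-1))"
proof (rule nn_integral_FTC_Icc)
  fix x assume "x \<in> {-1..a}"
  show "(tail_primitive has_real_derivative tail True x) (at x)"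
  proof -
    have "((\<lambda>u::real. u / 2 - u\<^sup>2 / 2) has_real_derivative 1/2 - x) (at x)"
      by (auto intro!: derivative_eq_intros)
    from DERIV_add[OF this DERIV_cdivide[OF DERIV_abs_cube, of 6]]
    show ?thesis
      by (simp add: tail_primitive_def[abs_def] tail_def)
  qed
  from \<open>x \<in> _\<close> a show "0 \<le> tail True x" by (intro tail_nonneg) auto
qed (use a in auto)

text \<open>
  The analytic core. Replacing \<open>\<bar>t v\<bar>\<^sup>3\<close> by the smaller \<open>(t v)\<^sup>4\<close> turns the left integrand into a
  polynomial \<open>P\<close>, whose integral exceeds the value \<open>20/9\<close> at \<open>t = 0\<close> by
  \<open>t (1/3 - 2t/5 + 8t\<^sup>3/105)\<close>. The bracket decreases on \<open>[0, 1]\<close> to \<open>1/105\<close>, so the crude bound is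
  just sharp enough.
\<close>

lemma tail_integral_slanted_ge_straight:
  assumes t: "0 \<le> t" "t \<le> 1"
  shows "(\<integral>\<^sup>+v. ennreal (tail False v) * ennreal (tail_primitive (- t * v) - tail_primitive (-1)) * indicator {-1..1} v \<partial>lborel)
     \<ge> (\<integral>\<^sup>+v. ennreal (tail False v) * ennreal (tail_primitive (- 0 * v) - tail_primitive (-1)) * indicator {-1..1} v \<partial>lborel)"
proof -
  define P where "P v = (3/2 - v - v\<^sup>2/2) * (5/6 - t * v / 2 - t\<^sup>2 * v\<^sup>2 / 2 + t^4 * v^4 / 6)" for v
  have "(\<integral>\<^sup>+v. ennreal (tail False v) * ennreal (tail_primitive (- 0 * v) - tail_primitive (-1)) * indicator {-1..1} v \<partial>lborel)
      = (\<integral>\<^sup>+v. ennreal ((5/6) * (3/2 - v - v\<^sup>2/2)) * indicator {-1..1} v \<partial>lborel)"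
    by (rule nn_integral_cong)
       (auto simp: tail_def tail_primitive_def indicator_def ennreal_mult'[symmetric] ennreal_mult''[symmetric] mult.commute)
  also have "\<dots> = ennreal ((5/6) * (3/2 * 1 - 1\<^sup>2/2 - 1^3/6) - (5/6) * (3/2 * (-1) - (-1)\<^sup>2/2 - (-1)^3/6))"
  proof (rule nn_integral_FTC_Icc[where F = "\<lambda>v. (5/6) * (3/2 * v - v\<^sup>2/2 - v^3/6)"])
    fix x :: real assume x: "x \<in> {-1..1}"
    show "((\<lambda>v. (5/6) * (3/2 * v - v\<^sup>2/2 - v^3/6)) has_real_derivative 5/6 * (3/2 - x - x\<^sup>2/2)) (at x)"
      by (auto intro!: derivative_eq_intros)
    show "0 \<le> 5/6 * (3/2 - x - x\<^sup>2/2)" using tail_nonneg[OF x, of False] by (simp add: tail_def)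
  qed auto
  also have "\<dots> = ennreal (20/9)" by simp
  also have "\<dots> \<le> ennreal (20/9 + (t/3 - 2/5 * t\<^sup>2 + 8/105 * t^4))"
  proof (rule ennreal_leI)
    have "0 \<le> t * (1/3 - 2/5 * t + 8/105 * t^3)"
    proof (intro mult_nonneg_nonneg t)
      have "35 - 42 * t + 8 * t ^ 3 = 1 + 2 * ((1 - t) * (17 - 4 * t - 4 * t\<^sup>2))"
        by (simp add: algebra_simps power2_eq_square power3_eq_cube)
      moreover have "t\<^sup>2 \<le> 1" using t by (simp add: power_le_one)
      then have "0 \<le> (1 - t) * (17 - 4 * t - 4 * t\<^sup>2)" using t by (intro mult_nonneg_nonneg) linarith+
      ultimately show "0 \<le> 1/3 - 2/5 * t + 8/105 * t^3" by linarith
    qed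
    then show "20/9 \<le> 20/9 + (t/3 - 2/5 * t\<^sup>2 + 8/105 * t^4)"
      by (simp add: algebra_simps power2_eq_square power4_eq_xxxx power3_eq_cube)
  qed
  also have "\<dots> = (\<integral>\<^sup>+v. ennreal (P v) * indicator {-1..1} v \<partial>lborel)"
  proof -
    define F where "F v = (5/4 * v - 5/6 * v^2/2 - 5/12 * v^3/3)
       - t * (3/4 * v^2/2 - v^3/6 - v^4/16) - t\<^sup>2 * (3/4 * v^3/3 - v^4/8 - v^5/20)
       + t^4 * (v^5/20 - v^6/36 - v^7/84)" for v :: real
    have "(\<integral>\<^sup>+v. ennreal (P v) * indicator {-1..1} v \<partial>lborel) = ennreal (F 1 - F (-1))"
    proof (rule nn_integral_FTC_Icc)
      fix x :: real assume x: "x \<in> {-1..1}"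
      show "(F has_real_derivative P x) (at x)"
        unfolding F_def P_def
        by (auto intro!: derivative_eq_intros
            simp: One_nat_def field_simps power2_eq_square power3_eq_cube power4_eq_xxxx eval_nat_numeral)
      \<comment> \<open>Nonnegativity of the second factor, as a polynomial with the root \<open>u = -1\<close>.\<close>
      define u where "u = - t * x"
      have "\<bar>t * x\<bar> \<le> 1" using t x by (auto simp: abs_mult intro!: mult_le_one)
      then have u: "-1 \<le> u" "u \<le> 1" by (auto simp: u_def)
      have eq: "5/6 - t * x / 2 - t\<^sup>2 * x\<^sup>2 / 2 + t^4 * x^4 / 6 = (1 + u) * (u^3 - u\<^sup>2 - 2 * u + 5) / 6"
        by (simp add: u_def algebra_simps power2_eq_square power3_eq_cube power4_eq_xxxx)
      have "u^3 \<ge> -1" "u\<^sup>2 \<le> 1"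
        using power_mono_odd[of 3 "-1" u] u by (auto simp: abs_square_le_1 abs_le_iff)
      then have "0 \<le> 5/6 - t * x / 2 - t\<^sup>2 * x\<^sup>2 / 2 + t^4 * x^4 / 6"
        unfolding eq using u by (auto intro!: divide_nonneg_nonneg mult_nonneg_nonneg)
      with tail_nonneg[OF x, of False] show "0 \<le> P x" by (auto simp: P_def tail_def)
    qed (auto simp: P_def)
    moreover have "F 1 - F (-1) = 20/9 + (t/3 - 2/5 * t\<^sup>2 + 8/105 * t^4)"
      by (simp add: F_def field_simps)
    ultimately show ?thesis by simp
  qed
  also have "\<dots> \<le> (\<integral>\<^sup>+v. ennreal (tail False v) * ennreal (tail_primitive (- t * v) - tail_primitive (-1)) * indicator {-1..1} v \<partial>lborel)"
  proof (rule nn_integral_mono)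
    fix v :: real
    show "ennreal (P v) * indicator {-1..1} v
       \<le> ennreal (tail False v) * ennreal (tail_primitive (- t * v) - tail_primitive (-1)) * indicator {-1..1} v"
    proof (cases "v \<in> {-1..1}")
      case True
      have "\<bar>t * v\<bar> \<le> 1" using t True by (auto simp: abs_mult intro!: mult_le_one)
      then have "\<bar>t * v\<bar> ^ 4 \<le> \<bar>t * v\<bar> ^ 3" by (intro power_decreasing) auto
      then have "t^4 * v^4 \<le> \<bar>t * v\<bar> ^ 3" by (simp add: power_mult_distrib)
      then have "P v \<le> tail False v * (tail_primitive (- t * v) - tail_primitive (-1))"
        using tail_nonneg[OF True, of False] unfolding P_def
        by (auto simp: tail_def tail_primitive_def power_mult_distrib intro!: mult_left_mono)
      then have "ennreal (P v) \<le> ennreal (tail False v * (tail_primitive (- t * v) - tail_primitive (-1)))" by (rule ennreal_leI)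
      then show ?thesis using True tail_nonneg[OF True, of False] by (simp add: ennreal_mult')
    qed auto
  qed
  finally show ?thesis .
qed

section \<open>Integrals over products\<close>

text \<open>
  A slanted cut couples only the coordinates \<open>p\<close> and \<open>q\<close>; all others contribute one-dimensional factors.
\<close>

lemma nn_integral_leb_separate_two:
  fixes G :: "real \<Rightarrow> real \<Rightarrow> ennreal" and w :: "nat \<Rightarrow> real \<Rightarrow> ennreal"
  assumes pq: "p \<in> {1..d}" "q \<in> {1..d}" "p \<noteq> q"
    and G[measurable]: "(\<lambda>(u, v). G u v) \<in> borel_measurable (borel \<Otimes>\<^sub>M borel)"
    and w[measurable]: "\<And>j. w j \<in> borel_measurable borel"
  shows "(\<integral>\<^sup>+x. G (x p) (x q) * (\<Prod>j\<in>{1..d}-{p,q}. w j (x j)) \<partial>leb d)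
       = (\<integral>\<^sup>+v. \<integral>\<^sup>+u. G u v \<partial>lborel \<partial>lborel) * (\<Prod>j\<in>{1..d}-{p,q}. \<integral>\<^sup>+u. w j u \<partial>lborel)"
proof -
  define I where "I = {1..d} - {p,q}"
  have I: "finite I" "p \<notin> I" "q \<notin> insert p I" "{1..d} = insert q (insert p I)"
    using pq by (auto simp: I_def)
  let ?f = "\<lambda>x. G (x p) (x q) * (\<Prod>j\<in>I. w j (x j))"
  have f1[measurable]: "?f \<in> borel_measurable (PiM (insert q (insert p I)) (\<lambda>_. lborel))"
    by measurable
  have "(\<integral>\<^sup>+x. ?f x \<partial>leb d) = (\<integral>\<^sup>+v. \<integral>\<^sup>+x. ?f (x(q := v)) \<partial>PiM (insert p I) (\<lambda>_. lborel) \<partial>lborel)"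
    unfolding I(4) using I f1 by (intro leb.product_nn_integral_insert_rev) auto
  also have "\<dots> = (\<integral>\<^sup>+v. \<integral>\<^sup>+u. \<integral>\<^sup>+x. ?f (x(p := u, q := v)) \<partial>PiM I (\<lambda>_. lborel) \<partial>lborel \<partial>lborel)"
  proof (rule nn_integral_cong)
    fix v :: real
    have "(\<lambda>x. ?f (x(q := v))) \<in> borel_measurable (PiM (insert p I) (\<lambda>_. lborel))"
      by (rule measurable_compose[OF _ f1]) (rule measurable_fun_upd[where J = "insert p I"]; auto)
    then show "(\<integral>\<^sup>+x. ?f (x(q := v)) \<partial>PiM (insert p I) (\<lambda>_. lborel))
      = (\<integral>\<^sup>+u. \<integral>\<^sup>+x. ?f (x(p := u, q := v)) \<partial>PiM I (\<lambda>_. lborel) \<partial>lborel)"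
      using I by (intro leb.product_nn_integral_insert_rev) auto
  qed
  also have "\<dots> = (\<integral>\<^sup>+v. \<integral>\<^sup>+u. G u v * (\<Prod>j\<in>I. \<integral>\<^sup>+u. w j u \<partial>lborel) \<partial>lborel \<partial>lborel)"
  proof (intro nn_integral_cong)
    fix u v :: real
    have "(\<integral>\<^sup>+x. ?f (x(p := u, q := v)) \<partial>PiM I (\<lambda>_. lborel))
        = (\<integral>\<^sup>+x. G u v * (\<Prod>j\<in>I. w j (x j)) \<partial>PiM I (\<lambda>_. lborel))"
      using I pq by (intro nn_integral_cong arg_cong2[where f="(*)"] prod.cong) auto
    also have "\<dots> = G u v * (\<Prod>j\<in>I. \<integral>\<^sup>+u. w j u \<partial>lborel)"
      using I by (subst nn_integral_cmult) (auto simp: leb.product_nn_integral_prod)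
    finally show "(\<integral>\<^sup>+x. ?f (x(p := u, q := v)) \<partial>PiM I (\<lambda>_. lborel))
      = G u v * (\<Prod>j\<in>I. \<integral>\<^sup>+u. w j u \<partial>lborel)" .
  qed
  also have "\<dots> = (\<integral>\<^sup>+v. \<integral>\<^sup>+u. G u v \<partial>lborel \<partial>lborel) * (\<Prod>j\<in>I. \<integral>\<^sup>+u. w j u \<partial>lborel)"
    by (simp add: nn_integral_multc)
  finally show ?thesis unfolding I_def .
qed

lemma measure_leb_PiE:
  assumes "\<And>j. j \<in> {1..d} \<Longrightarrow> A j \<in> sets borel"
  shows "measure (leb d) (PiE {1..d} A) = (\<Prod>j\<in>{1..d}. measure lborel (A j))"
proof -
  have "enn2real (\<Prod>j\<in>J. f j) = (\<Prod>j\<in>J. enn2real (f j))" for J :: "nat set" and f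
    by (induction J rule: infinite_finite_induct) (auto simp: enn2real_mult)
  then show ?thesis
    using assms unfolding measure_def by (subst leb.emeasure_PiM) auto
qed

lemma measure_Icc_Int_Ico:
  fixes a b c :: real
  assumes "0 \<le> a" "a \<le> b"
  shows "measure lborel ({a..b} \<inter> {0..<c}) = max 0 (min b c - a)"
proof (cases "c \<le> b")
  case True
  then have "{a..b} \<inter> {0..<c} = {a..<c}" using assms by auto
  then show ?thesis using True by (cases "a \<le> c") auto
next
  case False
  then have "{a..b} \<inter> {0..<c} = {a..b}" using assms by auto
  then show ?thesis using False assms by auto
qed

lemma mult_profile_rel_coord:
  assumes "0 < \<rho>"
  shows "\<rho> * profile False (rel_coord \<rho> z) = max 0 (z - (1 - 2 * \<rho>))"
    and "\<rho> * profile True (rel_coord \<rho> z) = max 0 (\<rho> - \<bar>z - 1 + \<rho>\<bar>)"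
proof -
  have n: "\<rho> * rel_coord \<rho> z = z - 1 + \<rho>" using assms by (simp add: rel_coord_def field_simps)
  then have "\<rho> * (1 + rel_coord \<rho> z) = z - (1 - 2 * \<rho>)" by (simp add: distrib_left)
  moreover have "\<rho> * \<bar>rel_coord \<rho> z\<bar> = \<bar>z - 1 + \<rho>\<bar>"
    using assms by (simp add: abs_mult flip: n)
  then have "\<rho> * (1 - \<bar>rel_coord \<rho> z\<bar>) = \<rho> - \<bar>z - 1 + \<rho>\<bar>" by (simp add: right_diff_distrib)
  ultimately show "\<rho> * profile False (rel_coord \<rho> z) = max 0 (z - (1 - 2 * \<rho>))"
    and "\<rho> * profile True (rel_coord \<rho> z) = max 0 (\<rho> - \<bar>z - 1 + \<rho>\<bar>)"
    using assms by (auto simp: profile_def max_mult_distrib_left)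
qed

lemma integrable_ucube:
  fixes f :: "(nat \<Rightarrow> real) \<Rightarrow> real"
  assumes "f \<in> borel_measurable (leb d)" "\<And>z. z \<in> unit_cube d \<Longrightarrow> \<bar>f z\<bar> \<le> B"
  shows "integrable (ucube d) f"
proof -
  interpret prob_space "ucube d" by (rule prob_space_ucube)
  show ?thesis
    by (rule integrable_const_bound[where B = B])
       (use assms in \<open>auto simp: space_ucube intro!: measurable_restrict_space1\<close>)
qed

lemma measurable_measure_Int_anchored_box:
  assumes [measurable]: "A \<in> sets (leb d)" and fin: "emeasure (leb d) A < \<infinity>"
  shows "(\<lambda>z. measure (leb d) (A \<inter> anchored_box d z)) \<in> borel_measurable (leb d)"
proof -
  let ?P = "density (leb d) (indicator A)"
  have "finite_measure ?P"
    using fin sets.sets_into_space[OF assms(1)]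
    by (intro finite_measureI) (simp add: emeasure_restricted Int_absorb2)
  then have "sigma_finite_measure ?P" by (simp add: finite_measure_def)
  then have "(\<lambda>z. measure ?P (anchored_box d z)) \<in> borel_measurable (leb d)"
    by (rule measurable_measure_anchored_box) simp
  then show ?thesis by (simp add: measure_def emeasure_restricted)
qed

section \<open>Cutting a cuboid in the corner of the unit cube\<close>

text \<open>
  A cuboid with half edge lengths \<open>r j\<close> whose upper corner is the point \<open>(1, ..., 1)\<close>. The directions \<open>p\<close>
  and \<open>q\<close> stay variable, so that steep and flat lines are treated by the same argument.
\<close>

locale corner_cuboid =
  fixes d :: nat and r :: "nat \<Rightarrow> real"
  assumes r_pos: "j \<in> {1..d} \<Longrightarrow> 0 < r j" and r_le: "j \<in> {1..d} \<Longrightarrow> 2 * r j \<le> 1"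
begin

definition whole :: "(nat \<Rightarrow> real) set" where
  "whole = PiE {1..d} (\<lambda>j. {1 - 2 * r j .. 1})"

definition cut :: "nat \<Rightarrow> nat \<Rightarrow> real \<Rightarrow> (nat \<Rightarrow> real) set" where
  "cut p q t = {x \<in> whole. rel_coord (r p) (x p) \<le> - t * rel_coord (r q) (x q)}"

lemma sets_whole [measurable]: "whole \<in> sets (leb d)"
  unfolding whole_def by (intro sets_PiM_I_finite) auto

lemma whole_subset_unit_cube: "whole \<subseteq> unit_cube d"
  using r_le by (force simp: whole_def unit_cube_def PiE_iff)

lemma mem_whole: "x \<in> space (leb d) \<Longrightarrow> x \<in> whole \<longleftrightarrow> (\<forall>j\<in>{1..d}. rel_coord (r j) (x j) \<in> {-1..1})"
  by (auto simp: whole_def space_PiM PiE_iff rel_coord_bounds r_pos)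

lemma sets_cut [measurable]:
  assumes "p \<in> {1..d}" "q \<in> {1..d}"
  shows "cut p q t \<in> sets (leb d)"
proof -
  have "{x \<in> space (leb d). rel_coord (r p) (x p) \<le> - t * rel_coord (r q) (x q)} \<in> sets (leb d)"
    using assms by measurable
  then have "whole \<inter> {x \<in> space (leb d). rel_coord (r p) (x p) \<le> - t * rel_coord (r q) (x q)} \<in> sets (leb d)"
    by (rule sets.Int[OF sets_whole])
  also have "whole \<inter> {x \<in> space (leb d). rel_coord (r p) (x p) \<le> - t * rel_coord (r q) (x q)} = cut p q t"
    using sets.sets_into_space[OF sets_whole] by (auto simp: cut_def)
  finally show ?thesis .
qed

text \<open>
  For \<open>0 \<le> t \<le> 1\<close> and \<open>v\<close> in \<open>[-1, 1]\<close> the bound \<open>- t v\<close> stays in \<open>[-1, 1]\<close>, so the inner integral needs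
  no truncation from above.
\<close>

lemma nn_integral_cut:
  assumes pq: "p \<in> {1..d}" "q \<in> {1..d}" "p \<noteq> q" and t: "0 \<le> t" "t \<le> 1"
    and \<psi>[measurable]: "\<And>j. \<psi> j \<in> borel_measurable borel"
  shows "(\<integral>\<^sup>+x. (\<Prod>j\<in>{1..d}. \<psi> j (rel_coord (r j) (x j))) * indicator (cut p q t) x \<partial>leb d)
    = (\<integral>\<^sup>+v. \<psi> q v * (\<integral>\<^sup>+u. \<psi> p u * indicator {-1..- t * v} u \<partial>lborel) * indicator {-1..1} v \<partial>lborel)
      * (ennreal (r p) * ennreal (r q) *
        (\<Prod>j\<in>{1..d}-{p,q}. ennreal (r j) * (\<integral>\<^sup>+u. \<psi> j u * indicator {-1..1} u \<partial>lborel)))"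
proof -
  define G where "G u v = \<psi> p (rel_coord (r p) u) * indicator {-1..- t * rel_coord (r q) v} (rel_coord (r p) u)
     * (\<psi> q (rel_coord (r q) v) * indicator {-1..1} (rel_coord (r q) v))" for u v
  define w where "w j u = \<psi> j (rel_coord (r j) u) * indicator {-1..1} (rel_coord (r j) u)" for j u
  have D: "{1..d} = insert p (insert q ({1..d} - {p,q}))" using pq by auto
  have cut_iff: "x \<in> cut p q t \<longleftrightarrow> rel_coord (r p) (x p) \<in> {-1..- t * rel_coord (r q) (x q)} \<and> rel_coord (r q) (x q) \<in> {-1..1}
      \<and> (\<forall>j\<in>{1..d}-{p,q}. rel_coord (r j) (x j) \<in> {-1..1})" if "x \<in> space (leb d)" for x
  proof -
    have "- t * s \<le> 1" if "s \<in> {-1..1}" for s :: real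
      using t that mult_mono[of t 1 "-s" 1] by (cases "s \<le> 0") (auto intro: order_trans[of _ 0])
    then show ?thesis
      unfolding cut_def using mem_whole[OF that] pq by (subst (asm) D) (force intro: order_trans)
  qed
  have "(\<integral>\<^sup>+x. (\<Prod>j\<in>{1..d}. \<psi> j (rel_coord (r j) (x j))) * indicator (cut p q t) x \<partial>leb d)
     = (\<integral>\<^sup>+x. G (x p) (x q) * (\<Prod>j\<in>{1..d}-{p,q}. w j (x j)) \<partial>leb d)"
  proof (rule nn_integral_cong)
    fix x assume x: "x \<in> space (leb d)"
    have *: "(\<Prod>j\<in>{1..d}. \<psi> j (rel_coord (r j) (x j))) = \<psi> p (rel_coord (r p) (x p)) * (\<psi> q (rel_coord (r q) (x q)) *
       (\<Prod>j\<in>{1..d}-{p,q}. \<psi> j (rel_coord (r j) (x j))))"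
      by (subst D) (use pq in simp)
    show "(\<Prod>j\<in>{1..d}. \<psi> j (rel_coord (r j) (x j))) * indicator (cut p q t) x
      = G (x p) (x q) * (\<Prod>j\<in>{1..d}-{p,q}. w j (x j))"
    proof (cases "x \<in> cut p q t")
      case True
      then have "(\<Prod>j\<in>{1..d}-{p,q}. w j (x j)) = (\<Prod>j\<in>{1..d}-{p,q}. \<psi> j (rel_coord (r j) (x j)))"
        using cut_iff[OF x] by (intro prod.cong) (auto simp: w_def)
      then show ?thesis using True cut_iff[OF x] unfolding * by (simp add: G_def mult.assoc)
    next
      case False
      then consider "G (x p) (x q) = 0" | "\<exists>j\<in>{1..d}-{p,q}. w j (x j) = 0"
        unfolding cut_iff[OF x] G_def w_def by (auto simp: indicator_def split: if_splits)
      then show ?thesis using False by cases (auto simp: prod_zero_iff)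
    qed
  qed
  also have "\<dots> = (\<integral>\<^sup>+v. \<integral>\<^sup>+u. G u v \<partial>lborel \<partial>lborel) * (\<Prod>j\<in>{1..d}-{p,q}. \<integral>\<^sup>+u. w j u \<partial>lborel)"
  proof (rule nn_integral_leb_separate_two[OF pq])
    show "(\<lambda>(u, v). G u v) \<in> borel_measurable (borel \<Otimes>\<^sub>M borel)"
      unfolding G_def indicator_def split_beta' atLeastAtMost_iff by measurable
    show "w j \<in> borel_measurable borel" for j
      unfolding w_def[abs_def] by measurable
  qed
  also have "(\<Prod>j\<in>{1..d}-{p,q}. \<integral>\<^sup>+u. w j u \<partial>lborel)
     = (\<Prod>j\<in>{1..d}-{p,q}. ennreal (r j) * (\<integral>\<^sup>+u. \<psi> j u * indicator {-1..1} u \<partial>lborel))"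
    unfolding w_def
    by (intro prod.cong refl nn_integral_rel_coord[of "\<lambda>u. \<psi> _ u * indicator {-1..1} u"]) (auto intro: r_pos)
  also have "(\<integral>\<^sup>+v. \<integral>\<^sup>+u. G u v \<partial>lborel \<partial>lborel)
     = (\<integral>\<^sup>+v. ennreal (r p) * ((\<lambda>v. \<psi> q v * (\<integral>\<^sup>+u. \<psi> p u * indicator {-1..- t * v} u \<partial>lborel) * indicator {-1..1} v) (rel_coord (r q) v)) \<partial>lborel)"
  proof (rule nn_integral_cong)
    fix v
    have "(\<integral>\<^sup>+u. G u v \<partial>lborel) = (\<integral>\<^sup>+u. (\<lambda>u. \<psi> p u * indicator {-1..- t * rel_coord (r q) v} u) (rel_coord (r p) u) \<partial>lborel)
        * (\<psi> q (rel_coord (r q) v) * indicator {-1..1} (rel_coord (r q) v))"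
      unfolding G_def by (subst nn_integral_multc) auto
    also have "\<dots> = ennreal (r p) * (\<integral>\<^sup>+u. \<psi> p u * indicator {-1..- t * rel_coord (r q) v} u \<partial>lborel)
        * (\<psi> q (rel_coord (r q) v) * indicator {-1..1} (rel_coord (r q) v))"
      by (subst nn_integral_rel_coord) (use pq r_pos in auto)
    finally show "(\<integral>\<^sup>+u. G u v \<partial>lborel) = ennreal (r p) * ((\<lambda>v. \<psi> q v * (\<integral>\<^sup>+u. \<psi> p u * indicator {-1..- t * v} u \<partial>lborel) * indicator {-1..1} v) (rel_coord (r q) v))"
      by (simp add: ac_simps)
  qed
  also have "\<dots> = ennreal (r p) * (ennreal (r q) * (\<integral>\<^sup>+v. \<psi> q v * (\<integral>\<^sup>+u. \<psi> p u * indicator {-1..- t * v} u \<partial>lborel) * indicator {-1..1} v \<partial>lborel))"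
  proof -
    have m[measurable]: "(\<lambda>v. \<integral>\<^sup>+u. \<psi> p u * indicator {-1..- t * v} u \<partial>lborel) \<in> borel_measurable borel"
    proof -
      have "(\<lambda>(v, u). \<psi> p u * indicator {-1..- t * v} u) \<in> borel_measurable (borel \<Otimes>\<^sub>M lborel)"
        unfolding indicator_def atLeastAtMost_iff by measurable
      then show ?thesis by (rule lborel.borel_measurable_nn_integral)
    qed
    have h: "(\<lambda>v. \<psi> q v * (\<integral>\<^sup>+u. \<psi> p u * indicator {-1..- t * v} u \<partial>lborel) * indicator {-1..1} v) \<in> borel_measurable borel"
      by measurable
    show ?thesis
      unfolding nn_integral_rel_coord[OF h r_pos[OF pq(2)], symmetric]
      by (rule nn_integral_cmult) (use measurable_compose[OF rel_coord_measurable h] in simp)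
  qed
  finally show ?thesis by (simp add: ac_simps)
qed

lemma emeasure_whole: "emeasure (leb d) whole = ennreal (\<Prod>j\<in>{1..d}. 2 * r j)"
proof -
  have "emeasure (leb d) whole = (\<Prod>j\<in>{1..d}. emeasure lborel {1 - 2 * r j..1})"
    unfolding whole_def by (subst leb.emeasure_PiM) auto
  also have "\<dots> = (\<Prod>j\<in>{1..d}. ennreal (2 * r j))"
    by (intro prod.cong refl) (use r_pos in \<open>auto simp: less_imp_le\<close>)
  also have "\<dots> = ennreal (\<Prod>j\<in>{1..d}. 2 * r j)"
    by (intro prod_ennreal) (use r_pos in \<open>auto simp: less_imp_le\<close>)
  finally show ?thesis .
qed

lemma finite_subset_whole:
  assumes "A \<subseteq> whole"
  shows "emeasure (leb d) A < \<infinity>"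
proof -
  have "emeasure (leb d) A \<le> emeasure (leb d) whole" using assms by (intro emeasure_mono) auto
  also have "\<dots> < \<infinity>" by (simp add: emeasure_whole)
  finally show ?thesis .
qed

lemma cut_subset_whole: "cut p q t \<subseteq> whole" by (auto simp: cut_def)

text \<open>
  The cut passes through the centre: the slanted correction \<open>- t v\<close> integrates to zero.
\<close>

lemma emeasure_cut:
  assumes pq: "p \<in> {1..d}" "q \<in> {1..d}" "p \<noteq> q" and t: "0 \<le> t" "t \<le> 1"
  shows "emeasure (leb d) (cut p q t) = ennreal ((\<Prod>j\<in>{1..d}. 2 * r j) / 2)"
proof -
  have D: "{1..d} = insert p (insert q ({1..d} - {p,q}))" using pq by auto
  have bound: "- t * v \<in> {-1..1}" if "v \<in> {-1..1}" for v
  proof -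
    have "\<bar>t * v\<bar> \<le> 1" using t that by (auto simp: abs_mult intro!: mult_le_one)
    then show ?thesis by auto
  qed
  have "emeasure (leb d) (cut p q t) = (\<integral>\<^sup>+x. (\<Prod>j\<in>{1..d}. (\<lambda>_ _. 1) j (rel_coord (r j) (x j))) * indicator (cut p q t) x \<partial>leb d)"
    using pq by simp
  also have "\<dots> = (\<integral>\<^sup>+v. 1 * (\<integral>\<^sup>+u. 1 * indicator {-1..- t * v} u \<partial>lborel) * indicator {-1..1} v \<partial>lborel)
      * (ennreal (r p) * ennreal (r q) *
        (\<Prod>j\<in>{1..d}-{p,q}. ennreal (r j) * (\<integral>\<^sup>+u. 1 * indicator {-1..1::real} u \<partial>lborel)))"
    by (rule nn_integral_cut[OF pq t]) simp
  also have "(\<integral>\<^sup>+v. 1 * (\<integral>\<^sup>+u. 1 * indicator {-1..- t * v} u \<partial>lborel) * indicator {-1..1} v \<partial>lborel)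
     = (\<integral>\<^sup>+v. ennreal (1 - t * v) * indicator {-1..1} v \<partial>lborel)"
  proof (rule nn_integral_cong)
    fix v :: real
    show "1 * (\<integral>\<^sup>+u. 1 * indicator {-1..- t * v} u \<partial>lborel) * indicator {-1..1} v
        = ennreal (1 - t * v) * indicator {-1..1} v"
      using bound[of v] by (cases "v \<in> {-1..1}") simp_all
  qed
  also have "\<dots> = ennreal ((1 - t * 1\<^sup>2 / 2) - (-1 - t * (-1)\<^sup>2 / 2))"
  proof (rule nn_integral_FTC_Icc[where F = "\<lambda>v. v - t * v\<^sup>2 / 2"])
    fix v :: real assume "v \<in> {-1..1}"
    then show "0 \<le> 1 - t * v" using bound[of v] by auto
    show "((\<lambda>v. v - t * v\<^sup>2 / 2) has_real_derivative 1 - t * v) (at v)"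
      by (auto intro!: derivative_eq_intros)
  qed auto
  also have "\<dots> = ennreal 2" by simp
  also have "(\<Prod>j\<in>{1..d}-{p,q}. ennreal (r j) * (\<integral>\<^sup>+u. 1 * indicator {-1..1::real} u \<partial>lborel)) = ennreal (\<Prod>j\<in>{1..d}-{p,q}. 2 * r j)"
  proof (subst prod_ennreal[symmetric])
    show "0 \<le> 2 * r j" if "j \<in> {1..d} - {p, q}" for j using r_pos[of j] that by auto
    have "ennreal (r j) * (\<integral>\<^sup>+u. 1 * indicator {-1..1::real} u \<partial>lborel) = ennreal (2 * r j)" for j
      using ennreal_mult'[of 2 "r j"] by (simp add: mult.commute)
    then show "(\<Prod>j\<in>{1..d}-{p,q}. ennreal (r j) * (\<integral>\<^sup>+u. 1 * indicator {-1..1::real} u \<partial>lborel))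
      = (\<Prod>j\<in>{1..d}-{p,q}. ennreal (2 * r j))" by simp
  qed
  also have "ennreal 2 * (ennreal (r p) * ennreal (r q) * ennreal (\<Prod>j\<in>{1..d}-{p,q}. 2 * r j))
     = ennreal (2 * (r p * r q * (\<Prod>j\<in>{1..d}-{p,q}. 2 * r j)))"
    using r_pos pq by (simp add: ennreal_mult' less_imp_le mult.assoc prod_nonneg)
  also have "2 * (r p * r q * (\<Prod>j\<in>{1..d}-{p,q}. 2 * r j)) = (\<Prod>j\<in>{1..d}. 2 * r j) / 2"
    by (subst (2) D) (use pq in simp)
  finally show ?thesis .
qed

lemma emeasure_hyperplane:
  assumes pq: "p \<in> {1..d}" "q \<in> {1..d}" "p \<noteq> q"
  shows "emeasure (leb d) {x \<in> whole. rel_coord (r p) (x p) = - t * rel_coord (r q) (x q)} = 0"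
proof -
  have D: "{1..d} = insert p (insert q ({1..d} - {p,q}))" using pq by auto
  define H where "H = {x \<in> space (leb d). rel_coord (r p) (x p) = - t * rel_coord (r q) (x q)}"
  have H[measurable]: "H \<in> sets (leb d)" unfolding H_def using pq by measurable
  define G :: "real \<Rightarrow> real \<Rightarrow> ennreal" where "G u v = (if rel_coord (r p) u = - t * rel_coord (r q) v then 1 else 0)" for u v
  have "emeasure (leb d) H = (\<integral>\<^sup>+x. indicator H x \<partial>leb d)" by simp
  also have "\<dots> = (\<integral>\<^sup>+x. G (x p) (x q) * (\<Prod>j\<in>{1..d}-{p,q}. (\<lambda>_ _. 1) j (x j)) \<partial>leb d)"
    by (intro nn_integral_cong) (auto simp: G_def H_def)
  also have "\<dots> = (\<integral>\<^sup>+v. \<integral>\<^sup>+u. G u v \<partial>lborel \<partial>lborel) * (\<Prod>j\<in>{1..d}-{p,q}. \<integral>\<^sup>+u. 1 \<partial>(lborel :: real measure))"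
    by (rule nn_integral_leb_separate_two[OF pq]) (auto simp: G_def[abs_def] split_beta')
  also have "(\<integral>\<^sup>+v. \<integral>\<^sup>+u. G u v \<partial>lborel \<partial>lborel) = (\<integral>\<^sup>+v. 0 \<partial>(lborel :: real measure))"
  proof (rule nn_integral_cong)
    fix v
    have "(\<integral>\<^sup>+u. G u v \<partial>lborel) = (\<integral>\<^sup>+u. indicator {1 + r p * (- t * rel_coord (r q) v - 1)} u \<partial>lborel)"
      using r_pos[OF pq(1)] by (intro nn_integral_cong) (auto simp: G_def rel_coord_def[of "r p"] indicator_def field_simps)
    then show "(\<integral>\<^sup>+u. G u v \<partial>lborel) = 0" by simp
  qed
  finally have "emeasure (leb d) H = 0" by simp
  moreover have "{x \<in> whole. rel_coord (r p) (x p) = - t * rel_coord (r q) (x q)} \<subseteq> H"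
    using sets.sets_into_space[OF sets_whole] by (auto simp: H_def)
  ultimately show ?thesis by (rule emeasure_eq_0[OF H])
qed

definition cocut :: "nat \<Rightarrow> nat \<Rightarrow> real \<Rightarrow> (nat \<Rightarrow> real) set" where
  "cocut p q t = {x \<in> whole. rel_coord (r p) (x p) \<ge> - t * rel_coord (r q) (x q)}"

text \<open>
  A point of the cutting hyperplane is approached from outside the first part by moving it towards the
  corner \<open>(1, ..., 1)\<close>, which lies strictly on the other side.
\<close>

lemma closure_whole_diff_cut:
  assumes pq: "p \<in> {1..d}" "q \<in> {1..d}" "p \<noteq> q" and t: "0 \<le> t" "t \<le> 1"
  shows "closure (whole - cut p q t) = cocut p q t"
proof
  have closed_whole: "closed whole"
  proof -
    have "whole = (\<Inter>j\<in>{1..d}. {x. 1 - 2 * r j \<le> x j \<and> x j \<le> 1}) \<inter> (\<Inter>j\<in>-{1..d}. {x. x j = undefined})"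
      by (auto simp: whole_def PiE_iff extensional_def)
    also have "closed \<dots>"
      by (intro closed_Int closed_INT ballI closed_Collect_conj closed_Collect_le closed_Collect_eq
          continuous_on_const continuous_on_product_coordinates)
    finally show ?thesis .
  qed
  have coord: "continuous_on UNIV (\<lambda>x::nat\<Rightarrow>real. rel_coord (r j) (x j))" if "j \<in> {1..d}" for j
    unfolding rel_coord_def using r_pos[OF that] by (intro continuous_intros continuous_on_product_coordinates) auto
  have "closed (whole \<inter> {x. - t * rel_coord (r q) (x q) \<le> rel_coord (r p) (x p)})"
    by (intro closed_Int closed_whole closed_Collect_le coord continuous_on_mult_left pq)
  also have "whole \<inter> {x. - t * rel_coord (r q) (x q) \<le> rel_coord (r p) (x p)} = cocut p q t"
    by (auto simp: cocut_def)
  finally have "closed (cocut p q t)" .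
  then show "closure (whole - cut p q t) \<subseteq> cocut p q t"
    by (intro closure_minimal) (auto simp: cut_def cocut_def)
  show "cocut p q t \<subseteq> closure (whole - cut p q t)"
  proof
    fix x assume x: "x \<in> cocut p q t"
    then have xc: "x \<in> whole" by (simp add: cocut_def)
    \<comment> \<open>Points on the segment from \<open>x\<close> to the corner; outside \<open>{1..d}\<close> the value of \<open>x\<close> is kept, so that \<open>y \<epsilon>\<close> stays extensional.\<close>
    define y where "y \<epsilon> j = (if j \<in> {1..d} then x j + \<epsilon> * (1 - x j) else x j)" for \<epsilon> :: real and j
    have rel_y: "rel_coord (r j) (y \<epsilon> j) = (1 - \<epsilon>) * rel_coord (r j) (x j) + \<epsilon>" if "j \<in> {1..d}" for \<epsilon> j
      using that r_pos[OF that] by (simp add: y_def rel_coord_def field_simps)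
    have "y \<epsilon> \<in> whole - cut p q t" if \<epsilon>: "0 < \<epsilon>" "\<epsilon> < 1" for \<epsilon>
    proof -
      have "1 - 2 * r j \<le> y \<epsilon> j \<and> y \<epsilon> j \<le> 1" if j: "j \<in> {1..d}" for j
      proof -
        have xj: "1 - 2 * r j \<le> x j" "x j \<le> 1" using xc j by (auto simp: whole_def PiE_iff)
        then have "0 \<le> \<epsilon> * (1 - x j)" "\<epsilon> * (1 - x j) \<le> 1 * (1 - x j)"
          using \<epsilon> by (simp, intro mult_right_mono) auto
        then show ?thesis using xj j by (simp add: y_def)
      qed
      then have "y \<epsilon> \<in> whole"
        using xc by (auto simp: whole_def PiE_iff extensional_def y_def)
      moreover have "- t * rel_coord (r q) (y \<epsilon> q) < rel_coord (r p) (y \<epsilon> p)"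
      proof -
        have "0 \<le> (1 - \<epsilon>) * (rel_coord (r p) (x p) + t * rel_coord (r q) (x q))"
          using x \<epsilon> by (intro mult_nonneg_nonneg) (auto simp: cocut_def)
        moreover have "0 < \<epsilon> * (1 + t)" using \<epsilon> t by (intro mult_pos_pos) auto
        ultimately have "0 < (1 - \<epsilon>) * (rel_coord (r p) (x p) + t * rel_coord (r q) (x q)) + \<epsilon> * (1 + t)" by linarith
        then show ?thesis unfolding rel_y[OF pq(1)] rel_y[OF pq(2)] by (simp add: algebra_simps)
      qed
      ultimately show ?thesis by (simp add: cut_def)
    qed
    then have ev: "\<forall>\<^sub>F \<epsilon> in at_right 0. y \<epsilon> \<in> closure (whole - cut p q t)"
      by (intro eventually_at_rightI[of 0 1] subsetD[OF closure_subset]) auto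
    have "continuous_on UNIV (\<lambda>\<epsilon>. y \<epsilon> j)" for j
      unfolding y_def by (cases "j \<in> {1..d}") (auto intro!: continuous_intros)
    then have "continuous_on UNIV y"
      by (rule continuous_on_coordinatewise_then_product)
    then have "(y \<longlongrightarrow> y 0) (at_right 0)"
      by (auto simp: continuous_on_eq_continuous_at isCont_def intro: tendsto_within_subset)
    from Lim_in_closed_set[OF closed_closure ev _ this]
    have "y 0 \<in> closure (whole - cut p q t)" by simp
    moreover have "y 0 = x" by (auto simp: y_def)
    ultimately show "x \<in> closure (whole - cut p q t)" by simp
  qed
qed

text \<open>
  The two parts share only the section of the cuboid by the cutting hyperplane, which is a null set.
\<close>

lemma cut_cocut_split:
  assumes pq: "p \<in> {1..d}" "q \<in> {1..d}" "p \<noteq> q" and B[measurable]: "B \<in> sets (leb d)"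
  shows "cocut p q t \<in> sets (leb d)"
    and "measure (leb d) (cut p q t \<inter> B) + measure (leb d) (cocut p q t \<inter> B) = measure (leb d) (whole \<inter> B)"
proof -
  define H where "H = {x \<in> whole. rel_coord (r p) (x p) = - t * rel_coord (r q) (x q)}"
  have [measurable]: "cut p q t \<in> sets (leb d)" using pq by simp
  have "whole \<inter> {x \<in> space (leb d). rel_coord (r p) (x p) = - t * rel_coord (r q) (x q)} \<in> sets (leb d)"
    using pq by measurable
  also have "whole \<inter> {x \<in> space (leb d). rel_coord (r p) (x p) = - t * rel_coord (r q) (x q)} = H"
    using sets.sets_into_space[OF sets_whole] by (auto simp: H_def)
  finally have H[measurable]: "H \<in> sets (leb d)" .
  have eq: "cocut p q t = (whole - cut p q t) \<union> H" by (auto simp: cocut_def cut_def H_def)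
  show "cocut p q t \<in> sets (leb d)" unfolding eq by measurable
  have null: "H \<inter> B \<in> null_sets (leb d)"
    using emeasure_hyperplane[OF pq, of t] H by (intro null_set_Int2 B) (simp add: null_sets_def H_def)
  have "cocut p q t \<inter> B = ((whole - cut p q t) \<inter> B) \<union> (H \<inter> B)" using eq by auto
  then have "measure (leb d) (cocut p q t \<inter> B) = measure (leb d) ((whole - cut p q t) \<inter> B)"
    using null by (simp add: measure_def emeasure_Un_null_set)
  moreover have "whole \<inter> B = (cut p q t \<inter> B) \<union> ((whole - cut p q t) \<inter> B)" using cut_subset_whole by auto
  moreover have "measure (leb d) ((cut p q t \<inter> B) \<union> ((whole - cut p q t) \<inter> B))
      = measure (leb d) (cut p q t \<inter> B) + measure (leb d) ((whole - cut p q t) \<inter> B)"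
  proof (rule measure_Union)
    show "emeasure (leb d) (cut p q t \<inter> B) \<noteq> \<infinity>" "emeasure (leb d) ((whole - cut p q t) \<inter> B) \<noteq> \<infinity>"
      by (intro less_imp_neq[OF finite_subset_whole[OF le_infI1]] cut_subset_whole Diff_subset)+
  qed auto
  ultimately show "measure (leb d) (cut p q t \<inter> B) + measure (leb d) (cocut p q t \<inter> B) = measure (leb d) (whole \<inter> B)"
    by simp
qed

definition vol :: real where "vol = (\<Prod>j\<in>{1..d}. 2 * r j)"

lemma vol_pos: "0 < vol" unfolding vol_def using r_pos by (intro prod_pos) auto

lemma hit_prob_cut:
  assumes pq: "p \<in> {1..d}" "q \<in> {1..d}" "p \<noteq> q" and t: "0 \<le> t" "t \<le> 1"
  shows "hit_prob d (cut p q t) z = measure (leb d) (cut p q t \<inter> anchored_box d z) / (vol / 2)"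
    and "hit_prob d (cocut p q t) z = measure (leb d) (cocut p q t \<inter> anchored_box d z) / (vol / 2)"
proof -
  have e: "emeasure (leb d) (cut p q t) = ennreal (vol / 2)"
    unfolding vol_def by (rule emeasure_cut[OF pq t])
  then have m: "measure (leb d) (cut p q t) = vol / 2" using vol_pos by (simp add: measure_def)
  show "hit_prob d (cut p q t) z = measure (leb d) (cut p q t \<inter> anchored_box d z) / (vol / 2)"
    unfolding hit_prob_def using vol_pos by (subst measure_uniform_measure) (simp_all add: e m pq)
  have co: "cocut p q t \<subseteq> whole" by (auto simp: cocut_def)
  have sp: "A \<inter> space (leb d) = A" if "A \<subseteq> whole" for A
    using that sets.sets_into_space[OF sets_whole] by auto
  have "measure (leb d) (cocut p q t) = measure (leb d) whole - measure (leb d) (cut p q t)"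
    using cut_cocut_split(2)[OF pq sets.top, of t] sp[OF co] sp[OF cut_subset_whole] sp[OF subset_refl] by simp
  also have "measure (leb d) whole = vol"
    using vol_pos by (simp add: measure_def emeasure_whole vol_def)
  finally have m': "measure (leb d) (cocut p q t) = vol / 2" using m by simp
  have "emeasure (leb d) (cocut p q t) = ennreal (measure (leb d) (cocut p q t))"
    using finite_subset_whole[OF co] by (intro emeasure_eq_ennreal_measure) auto
  then show "hit_prob d (cocut p q t) z = measure (leb d) (cocut p q t \<inter> anchored_box d z) / (vol / 2)"
    unfolding hit_prob_def using vol_pos cut_cocut_split(1)[OF pq sets.top]
    by (subst measure_uniform_measure) (simp_all add: m')
qed

section \<open>Imbalance of a cut\<close>

lemma nn_integral_prod_rel_coord:
  assumes [measurable]: "\<And>j. f j \<in> borel_measurable borel"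
  shows "(\<integral>\<^sup>+z. (\<Prod>j\<in>{1..d}. f j (rel_coord (r j) (z j))) \<partial>leb d) = (\<Prod>j\<in>{1..d}. ennreal (r j) * (\<integral>\<^sup>+y. f j y \<partial>lborel))"
proof -
  have "(\<integral>\<^sup>+z. (\<Prod>j\<in>{1..d}. f j (rel_coord (r j) (z j))) \<partial>leb d)
     = (\<Prod>j\<in>{1..d}. \<integral>\<^sup>+y. f j (rel_coord (r j) y) \<partial>lborel)"
    by (rule leb.product_nn_integral_prod[of _ "\<lambda>j y. f j (rel_coord (r j) y)"]) auto
  also have "\<dots> = (\<Prod>j\<in>{1..d}. ennreal (r j) * (\<integral>\<^sup>+y. f j y \<partial>lborel))"
    by (intro prod.cong refl nn_integral_rel_coord) (auto intro: r_pos)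
  finally show ?thesis .
qed

lemma measure_whole_box:
  assumes "z \<in> unit_cube d"
  shows "measure (leb d) (whole \<inter> anchored_box d z) = (\<Prod>j\<in>{1..d}. r j * profile False (rel_coord (r j) (z j)))"
proof -
  have "whole \<inter> anchored_box d z = PiE {1..d} (\<lambda>j. {1 - 2 * r j..1} \<inter> {0..<z j})"
    by (auto simp: whole_def anchored_box_def PiE_iff)
  then have "measure (leb d) (whole \<inter> anchored_box d z)
     = (\<Prod>j\<in>{1..d}. measure lborel ({1 - 2 * r j..1} \<inter> {0..<z j}))"
    by (simp add: measure_leb_PiE)
  also have "\<dots> = (\<Prod>j\<in>{1..d}. r j * profile False (rel_coord (r j) (z j)))"
  proof (rule prod.cong[OF refl])
    fix j assume j: "j \<in> {1..d}"
    have z: "z j \<le> 1" using assms j by (auto simp: unit_cube_def PiE_iff)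
    have "r j * profile False (rel_coord (r j) (z j)) = max 0 (z j - (1 - 2 * r j))"
      by (rule mult_profile_rel_coord(1)[OF r_pos[OF j]])
    then show "measure lborel ({1 - 2 * r j..1} \<inter> {0..<z j}) = r j * profile False (rel_coord (r j) (z j))"
      using r_pos[OF j] r_le[OF j] z by (subst measure_Icc_Int_Ico) auto
  qed
  finally show ?thesis .
qed

text \<open>
  A straight cut is a product set, so its imbalance factors into the one-dimensional profiles.
\<close>

lemma imbalance_straight_cut:
  assumes z: "z \<in> unit_cube d" and p: "p \<in> {1..d}"
  shows "2 * measure (leb d) (cut p q 0 \<inter> anchored_box d z) - measure (leb d) (whole \<inter> anchored_box d z)
     = (\<Prod>j\<in>{1..d}. r j * profile (j = p) (rel_coord (r j) (z j)))"
proof -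
  have "cut p q 0 \<inter> anchored_box d z
      = PiE {1..d} (\<lambda>j. (if j = p then {1 - 2 * r j..1 - r j} else {1 - 2 * r j..1}) \<inter> {0..<z j})"
    (is "_ = PiE _ ?A")
  proof (rule set_eqI)
    fix x
    have A: "x j \<in> ?A j \<longleftrightarrow> x j \<in> {1 - 2 * r j..1} \<and> x j \<in> {0..<z j} \<and> (j = p \<longrightarrow> x p \<le> 1 - r p)" for j
      using r_pos[OF p] by auto
    have "x \<in> PiE {1..d} ?A \<longleftrightarrow> x \<in> whole \<and> x \<in> anchored_box d z \<and> x p \<le> 1 - r p"
      unfolding PiE_iff A whole_def anchored_box_def using p by blast
    then show "x \<in> cut p q 0 \<inter> anchored_box d z \<longleftrightarrow> x \<in> PiE {1..d} ?A"
      using rel_coord_bounds(3)[OF r_pos[OF p]] by (auto simp: cut_def)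
  qed
  then have "measure (leb d) (cut p q 0 \<inter> anchored_box d z)
     = (\<Prod>j\<in>{1..d}. measure lborel ((if j = p then {1 - 2 * r j..1 - r j} else {1 - 2 * r j..1}) \<inter> {0..<z j}))"
    by (simp add: measure_leb_PiE)
  also have "\<dots> = measure lborel ({1 - 2 * r p..1 - r p} \<inter> {0..<z p})
      * (\<Prod>j\<in>{1..d}-{p}. measure lborel ({1 - 2 * r j..1} \<inter> {0..<z j}))"
    using p by (subst prod.remove[of _ p]) auto
  also have "(\<Prod>j\<in>{1..d}-{p}. measure lborel ({1 - 2 * r j..1} \<inter> {0..<z j}))
      = (\<Prod>j\<in>{1..d}-{p}. r j * profile False (rel_coord (r j) (z j)))"
  proof (rule prod.cong[OF refl])
    fix j assume "j \<in> {1..d} - {p}"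
    then have j: "j \<in> {1..d}" by simp
    have z: "z j \<le> 1" using z j by (auto simp: unit_cube_def PiE_iff)
    have "r j * profile False (rel_coord (r j) (z j)) = max 0 (z j - (1 - 2 * r j))"
      by (rule mult_profile_rel_coord(1)[OF r_pos[OF j]])
    then show "measure lborel ({1 - 2 * r j..1} \<inter> {0..<z j}) = r j * profile False (rel_coord (r j) (z j))"
      using r_pos[OF j] r_le[OF j] z by (subst measure_Icc_Int_Ico) auto
  qed
  finally have c: "measure (leb d) (cut p q 0 \<inter> anchored_box d z) = measure lborel ({1 - 2 * r p..1 - r p} \<inter> {0..<z p})
      * (\<Prod>j\<in>{1..d}-{p}. r j * profile False (rel_coord (r j) (z j)))" .
  have half: "2 * measure lborel ({1 - 2 * r p..1 - r p} \<inter> {0..<z p}) - r p * profile False (rel_coord (r p) (z p))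
     = r p * profile True (rel_coord (r p) (z p))"
  proof -
    have z: "z p \<le> 1" using z p by (auto simp: unit_cube_def PiE_iff)
    have "r p * profile False (rel_coord (r p) (z p)) = max 0 (z p - (1 - 2 * r p))"
      by (rule mult_profile_rel_coord(1)[OF r_pos[OF p]])
    moreover have "r p * profile True (rel_coord (r p) (z p)) = max 0 (r p - \<bar>z p - 1 + r p\<bar>)"
      by (rule mult_profile_rel_coord(2)[OF r_pos[OF p]])
    ultimately show ?thesis
      using r_pos[OF p] r_le[OF p] z by (subst measure_Icc_Int_Ico) (auto simp: max_def min_def abs_if)
  qed
  have ref: "(\<Prod>j\<in>{1..d}. r j * profile (j = p) (rel_coord (r j) (z j)))
     = (r p * profile True (rel_coord (r p) (z p))) * (\<Prod>j\<in>{1..d}-{p}. r j * profile False (rel_coord (r j) (z j)))"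
    using p by (subst prod.remove[of _ p]) (auto intro!: prod.cong)
  have full: "(\<Prod>j\<in>{1..d}. r j * profile False (rel_coord (r j) (z j)))
     = (r p * profile False (rel_coord (r p) (z p))) * (\<Prod>j\<in>{1..d}-{p}. r j * profile False (rel_coord (r j) (z j)))"
    using p by (subst prod.remove[of _ p]) auto
  have "2 * (x * k) - y * k = (2 * x - y) * k" for x y k :: real by (simp add: algebra_simps)
  then show ?thesis
    unfolding measure_whole_box[OF assms(1)] c ref full half[symmetric] by (simp only:)
qed

abbreviation straight_profile :: "nat \<Rightarrow> (nat \<Rightarrow> real) \<Rightarrow> real" where
  "straight_profile p z \<equiv> \<Prod>j\<in>{1..d}. r j * profile (j = p) (rel_coord (r j) (z j))"

lemma straight_profile_nonneg: "0 \<le> straight_profile p z"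
  using r_pos by (intro prod_nonneg mult_nonneg_nonneg) (auto intro: less_imp_le)

lemma profile_indicator:
  assumes "j \<in> {1..d}"
  shows "profile b (rel_coord (r j) y) * indicator {0..1} y = profile b (rel_coord (r j) y) * indicator {-1..1} (rel_coord (r j) y)"
proof -
  have "profile b (rel_coord (r j) y) = 0" if "rel_coord (r j) y < -1" using that by (auto simp: profile_def)
  moreover have "0 \<le> y" if "-1 \<le> rel_coord (r j) y"
    using that rel_coord_bounds(2)[OF r_pos[OF assms]] r_le[OF assms] by auto
  ultimately show ?thesis
    using rel_coord_bounds(1)[OF r_pos[OF assms], of y] by (auto simp: indicator_def not_le)
qed

lemma indicator_unit_cube:
  assumes "z \<in> space (leb d)"
  shows "(indicator (unit_cube d) z :: real) = (\<Prod>j\<in>{1..d}. indicator {0..1} (z j))"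
proof -
  have iff: "z \<in> unit_cube d \<longleftrightarrow> (\<forall>j\<in>{1..d}. z j \<in> {0..1})"
    using assms by (simp add: unit_cube_def space_PiM PiE_iff)
  show ?thesis
  proof (cases "z \<in> unit_cube d")
    case True
    with iff show ?thesis by simp
  next
    case False
    with iff obtain j where "j \<in> {1..d}" "z j \<notin> {0..1}" by blast
    then have "\<exists>j\<in>{1..d}. indicator {0..1} (z j) = (0 :: real)" by (intro bexI[of _ j]) simp_all
    then have "(\<Prod>j\<in>{1..d}. indicator {0..1} (z j)) = (0 :: real)" by (intro prod_zero) simp_all
    with False show ?thesis by simp
  qed
qed

lemma integral_straight_profile_square:
  assumes p: "p \<in> {1..d}"
  shows "(LINT z|ucube d. (straight_profile p z)\<^sup>2) = (\<Prod>j\<in>{1..d}. r j ^ 3) * ((2/3) * (8/3) ^ (d - 1))"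
proof -
  have "(\<integral>\<^sup>+z. ennreal ((straight_profile p z)\<^sup>2) \<partial>ucube d)
      = (\<integral>\<^sup>+z. (\<Prod>j\<in>{1..d}. ennreal ((r j)\<^sup>2) * (ennreal ((profile (j = p) (rel_coord (r j) (z j)))\<^sup>2) * indicator {-1..1} (rel_coord (r j) (z j)))) \<partial>leb d)"
  proof (subst nn_integral_restrict_space)
    show "(\<integral>\<^sup>+z. ennreal ((straight_profile p z)\<^sup>2) * indicator (unit_cube d) z \<partial>leb d)
      = (\<integral>\<^sup>+z. (\<Prod>j\<in>{1..d}. ennreal ((r j)\<^sup>2) * (ennreal ((profile (j = p) (rel_coord (r j) (z j)))\<^sup>2) * indicator {-1..1} (rel_coord (r j) (z j)))) \<partial>leb d)"
    proof (rule nn_integral_cong)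
      fix z assume z: "z \<in> space (leb d)"
      have "ennreal ((straight_profile p z)\<^sup>2) * indicator (unit_cube d) z = ennreal ((straight_profile p z)\<^sup>2 * indicator (unit_cube d) z)"
        by (simp add: indicator_def)
      also have "(straight_profile p z)\<^sup>2 * indicator (unit_cube d) z = (\<Prod>j\<in>{1..d}. (r j)\<^sup>2 * (profile (j = p) (rel_coord (r j) (z j)) * (profile (j = p) (rel_coord (r j) (z j)) * indicator {0..1} (z j))))"
        unfolding indicator_unit_cube[OF z] prod.distrib[symmetric] prod_power_distrib
        by (intro prod.cong refl) (simp add: power2_eq_square)
      also have "\<dots> = (\<Prod>j\<in>{1..d}. (r j)\<^sup>2 * ((profile (j = p) (rel_coord (r j) (z j)))\<^sup>2 * indicator {-1..1} (rel_coord (r j) (z j))))"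
        by (intro prod.cong refl) (simp add: profile_indicator power2_eq_square)
      also have "ennreal \<dots> = (\<Prod>j\<in>{1..d}. ennreal ((r j)\<^sup>2) * (ennreal ((profile (j = p) (rel_coord (r j) (z j)))\<^sup>2) * indicator {-1..1} (rel_coord (r j) (z j))))"
        by (subst prod_ennreal[symmetric]) (auto simp: ennreal_mult' indicator_def intro!: prod.cong)
      finally show "ennreal ((straight_profile p z)\<^sup>2) * indicator (unit_cube d) z = (\<Prod>j\<in>{1..d}. ennreal ((r j)\<^sup>2) * (ennreal ((profile (j = p) (rel_coord (r j) (z j)))\<^sup>2) * indicator {-1..1} (rel_coord (r j) (z j))))" .
    qed
  qed simp
  also have "\<dots> = (\<Prod>j\<in>{1..d}. ennreal (r j) * (\<integral>\<^sup>+y. ennreal ((r j)\<^sup>2) * (ennreal ((profile (j = p) y)\<^sup>2) * indicator {-1..1} y) \<partial>lborel))"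
    by (rule nn_integral_prod_rel_coord[of "\<lambda>j y. ennreal ((r j)\<^sup>2) * (ennreal ((profile (j = p) y)\<^sup>2) * indicator {-1..1} y)"]) measurable
  also have "\<dots> = (\<Prod>j\<in>{1..d}. ennreal (r j ^ 3 * (if j = p then 2/3 else 8/3)))"
  proof (rule prod.cong[OF refl])
    fix j assume j: "j \<in> {1..d}"
    have "(\<integral>\<^sup>+y. ennreal ((r j)\<^sup>2) * (ennreal ((profile (j = p) y)\<^sup>2) * indicator {-1..1} y) \<partial>lborel) = ennreal ((r j)\<^sup>2) * ennreal (if j = p then 2/3 else 8/3)"
      by (subst nn_integral_cmult) (auto simp: nn_integral_profile_square)
    then show "ennreal (r j) * (\<integral>\<^sup>+y. ennreal ((r j)\<^sup>2) * (ennreal ((profile (j = p) y)\<^sup>2) * indicator {-1..1} y) \<partial>lborel)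
       = ennreal (r j ^ 3 * (if j = p then 2/3 else 8/3))"
      using r_pos[OF j] by (simp add: ennreal_mult[symmetric] power2_eq_square power3_eq_cube mult.assoc)
  qed
  also have "\<dots> = ennreal (\<Prod>j\<in>{1..d}. r j ^ 3 * (if j = p then 2/3 else 8/3))"
    using r_pos by (intro prod_ennreal) (auto intro!: mult_nonneg_nonneg zero_le_power less_imp_le)
  also have "(\<Prod>j\<in>{1..d}. r j ^ 3 * (if j = p then 2/3 else 8/3)) = (\<Prod>j\<in>{1..d}. r j ^ 3) * ((2/3) * (8/3) ^ (d - 1))"
  proof -
    have "(\<Prod>j\<in>{1..d}. if j = p then 2/3 else 8/3 :: real) = 2/3 * (\<Prod>j\<in>{1..d}-{p}. 8/3)"
      using p by (subst prod.remove[of _ p]) (auto intro!: prod.cong)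
    also have "\<dots> = 2/3 * (8/3) ^ (d - 1)" using p by simp
    finally show ?thesis by (simp add: prod.distrib)
  qed
  finally have "(\<integral>\<^sup>+z. ennreal ((straight_profile p z)\<^sup>2) \<partial>ucube d) = ennreal ((\<Prod>j\<in>{1..d}. r j ^ 3) * ((2/3) * (8/3) ^ (d - 1)))" .
  moreover have "0 \<le> (\<Prod>j\<in>{1..d}. r j ^ 3) * ((2/3) * (8/3) ^ (d - 1))"
    using r_pos by (intro mult_nonneg_nonneg prod_nonneg) (auto intro: less_imp_le)
  moreover have "(LINT z|ucube d. (straight_profile p z)\<^sup>2) = enn2real (\<integral>\<^sup>+z. ennreal ((straight_profile p z)\<^sup>2) \<partial>ucube d)"
    by (intro integral_eq_nn_integral) (auto intro!: measurable_restrict_space1)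
  ultimately show ?thesis by (simp only: enn2real_ennreal)
qed

text \<open>
  Fubini: integrating \<open>z\<close> first, over all corners above a point \<open>x\<close>, leaves the product of the tails at \<open>x\<close>.
\<close>

lemma nn_integral_straight_profile_mult_measure:
  assumes A[measurable]: "A \<in> sets (leb d)" and sub: "A \<subseteq> whole"
  shows "(\<integral>\<^sup>+z. ennreal (straight_profile p z * measure (leb d) (A \<inter> anchored_box d z)) \<partial>ucube d)
       = (\<integral>\<^sup>+x. (\<Prod>j\<in>{1..d}. ennreal ((r j)\<^sup>2 * tail (j = p) (rel_coord (r j) (x j)))) * indicator A x \<partial>leb d)"
proof -
  have pair: "pair_sigma_finite (leb d) (leb d)"
    using sigma_finite_leb by (simp add: pair_sigma_finite_def)
  have "(\<integral>\<^sup>+z. ennreal (straight_profile p z * measure (leb d) (A \<inter> anchored_box d z)) \<partial>ucube d)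
     = (\<integral>\<^sup>+z. ennreal (straight_profile p z * measure (leb d) (A \<inter> anchored_box d z)) * indicator (unit_cube d) z \<partial>leb d)"
    by (rule nn_integral_restrict_space) simp
  also have "\<dots> = (\<integral>\<^sup>+z. \<integral>\<^sup>+x. ennreal (straight_profile p z) * indicator (unit_cube d) z * (indicator A x * indicator (anchored_box d z) x) \<partial>leb d \<partial>leb d)"
  proof (rule nn_integral_cong)
    fix z
    have "A \<inter> anchored_box d z \<subseteq> whole" using sub by auto
    then have "ennreal (measure (leb d) (A \<inter> anchored_box d z)) = emeasure (leb d) (A \<inter> anchored_box d z)"
      using finite_subset_whole by (intro emeasure_eq_ennreal_measure[symmetric]) (simp add: less_top)
    also have "\<dots> = (\<integral>\<^sup>+x. indicator A x * indicator (anchored_box d z) x \<partial>leb d)"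
      by (simp add: indicator_inter_arith[symmetric])
    finally show "ennreal (straight_profile p z * measure (leb d) (A \<inter> anchored_box d z)) * indicator (unit_cube d) z
      = (\<integral>\<^sup>+x. ennreal (straight_profile p z) * indicator (unit_cube d) z * (indicator A x * indicator (anchored_box d z) x) \<partial>leb d)"
      by (subst nn_integral_cmult) (auto simp: ennreal_mult' straight_profile_nonneg ac_simps)
  qed
  also have "\<dots> = (\<integral>\<^sup>+x. \<integral>\<^sup>+z. ennreal (straight_profile p z) * indicator (unit_cube d) z * (indicator A x * indicator (anchored_box d z) x) \<partial>leb d \<partial>leb d)"
  proof (rule pair_sigma_finite.Fubini'[OF pair])
    have [measurable]: "Measurable.pred (leb d \<Otimes>\<^sub>M leb d) (\<lambda>w. fst w \<in> anchored_box d (snd w))"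
      by (rule measurable_mem_anchored_box)
    have [measurable]: "(\<lambda>w. indicator (anchored_box d (snd w)) (fst w) :: ennreal) \<in> borel_measurable (leb d \<Otimes>\<^sub>M leb d)"
      unfolding indicator_def by measurable
    show "(\<lambda>(x, z). ennreal (straight_profile p z) * indicator (unit_cube d) z * (indicator A x * indicator (anchored_box d z) x))
        \<in> borel_measurable (leb d \<Otimes>\<^sub>M leb d)"
      unfolding split_beta' by measurable
  qed
  also have "\<dots> = (\<integral>\<^sup>+x. (\<Prod>j\<in>{1..d}. ennreal ((r j)\<^sup>2 * tail (j = p) (rel_coord (r j) (x j)))) * indicator A x \<partial>leb d)"
  proof (rule nn_integral_cong)
    fix x assume x: "x \<in> space (leb d)"
    show "(\<integral>\<^sup>+z. ennreal (straight_profile p z) * indicator (unit_cube d) z * (indicator A x * indicator (anchored_box d z) x) \<partial>leb d)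
       = (\<Prod>j\<in>{1..d}. ennreal ((r j)\<^sup>2 * tail (j = p) (rel_coord (r j) (x j)))) * indicator A x"
    proof (cases "x \<in> A")
      case True
      then have xc: "x \<in> whole" using sub by auto
      have xj: "rel_coord (r j) (x j) \<in> {-1..1}" if "j \<in> {1..d}" for j
        using xc mem_whole[OF x] that by auto
      have x0: "0 \<le> x j" if "j \<in> {1..d}" for j
        using xc whole_subset_unit_cube that by (auto simp: unit_cube_def PiE_iff)
      have "(\<integral>\<^sup>+z. ennreal (straight_profile p z) * indicator (unit_cube d) z * (indicator A x * indicator (anchored_box d z) x) \<partial>leb d)
        = (\<integral>\<^sup>+z. (\<Prod>j\<in>{1..d}. (\<lambda>j y. ennreal (r j) * (ennreal (profile (j = p) y) * indicator {rel_coord (r j) (x j)<..1} y)) j (rel_coord (r j) (z j))) \<partial>leb d)"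
      proof (rule nn_integral_cong)
        fix z assume z: "z \<in> space (leb d)"
        have iff: "z \<in> unit_cube d \<and> x \<in> anchored_box d z \<longleftrightarrow>
            (\<forall>j\<in>{1..d}. rel_coord (r j) (z j) \<in> {rel_coord (r j) (x j)<..1})"
        proof -
          have "rel_coord (r j) (z j) \<in> {rel_coord (r j) (x j)<..1} \<longleftrightarrow> 0 \<le> z j \<and> z j \<le> 1 \<and> 0 \<le> x j \<and> x j < z j"
            if "j \<in> {1..d}" for j
            using x0[OF that] rel_coord_bounds(1,4)[OF r_pos[OF that]] by auto
          then show ?thesis
            using z by (auto simp: mem_anchored_box[OF x] unit_cube_def space_PiM PiE_iff)
        qed
        show "ennreal (straight_profile p z) * indicator (unit_cube d) z * (indicator A x * indicator (anchored_box d z) x)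
          = (\<Prod>j\<in>{1..d}. (\<lambda>j y. ennreal (r j) * (ennreal (profile (j = p) y) * indicator {rel_coord (r j) (x j)<..1} y)) j (rel_coord (r j) (z j)))"
        proof (cases "z \<in> unit_cube d \<and> x \<in> anchored_box d z")
          case in_box: True
          then have "(\<Prod>j\<in>{1..d}. (\<lambda>j y. ennreal (r j) * (ennreal (profile (j = p) y) * indicator {rel_coord (r j) (x j)<..1} y)) j (rel_coord (r j) (z j)))
            = (\<Prod>j\<in>{1..d}. ennreal (r j * profile (j = p) (rel_coord (r j) (z j))))"
            unfolding iff by (intro prod.cong) (simp_all add: ennreal_mult'[OF less_imp_le[OF r_pos]])
          also have "\<dots> = ennreal (straight_profile p z)"
            using r_pos by (intro prod_ennreal mult_nonneg_nonneg) (auto intro: less_imp_le)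
          finally show ?thesis using in_box True by simp
        next
          case False
          then obtain j where "j \<in> {1..d}" "rel_coord (r j) (z j) \<notin> {rel_coord (r j) (x j)<..1}" unfolding iff by blast
          then have "(\<Prod>j\<in>{1..d}. (\<lambda>j y. ennreal (r j) * (ennreal (profile (j = p) y) * indicator {rel_coord (r j) (x j)<..1} y)) j (rel_coord (r j) (z j))) = 0"
            by (intro prod_zero bexI[of _ j]) simp_all
          with False show ?thesis by (auto simp: indicator_def)
        qed
      qed
      also have "\<dots> = (\<Prod>j\<in>{1..d}. ennreal (r j) * (\<integral>\<^sup>+y. ennreal (r j) * (ennreal (profile (j = p) y) * indicator {rel_coord (r j) (x j)<..1} y) \<partial>lborel))"
        by (rule nn_integral_prod_rel_coord) measurable
      also have "\<dots> = (\<Prod>j\<in>{1..d}. ennreal ((r j)\<^sup>2 * tail (j = p) (rel_coord (r j) (x j))))"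
      proof (rule prod.cong[OF refl])
        fix j assume j: "j \<in> {1..d}"
        have "(\<integral>\<^sup>+y. ennreal (r j) * (ennreal (profile (j = p) y) * indicator {rel_coord (r j) (x j)<..1} y) \<partial>lborel)
           = ennreal (r j) * ennreal (tail (j = p) (rel_coord (r j) (x j)))"
          by (subst nn_integral_cmult) (auto simp: nn_integral_profile_above[OF xj[OF j]])
        then show "ennreal (r j) * (\<integral>\<^sup>+y. ennreal (r j) * (ennreal (profile (j = p) y) * indicator {rel_coord (r j) (x j)<..1} y) \<partial>lborel)
           = ennreal ((r j)\<^sup>2 * tail (j = p) (rel_coord (r j) (x j)))"
          using r_pos[OF j] by (simp add: ennreal_mult' power2_eq_square mult.assoc)
      qed
      finally show ?thesis using True by simp
    qed simp
  qed
  finally show ?thesis .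
qed

text \<open>
  Both sides are the same constant times the integral bounded in \<open>tail_integral_slanted_ge_straight\<close>.
\<close>

lemma nn_integral_straight_profile_cut_mono:
  assumes pq: "p \<in> {1..d}" "q \<in> {1..d}" "p \<noteq> q" and t: "0 \<le> t" "t \<le> 1"
  shows "(\<integral>\<^sup>+z. ennreal (straight_profile p z * measure (leb d) (cut p q 0 \<inter> anchored_box d z)) \<partial>ucube d)
       \<le> (\<integral>\<^sup>+z. ennreal (straight_profile p z * measure (leb d) (cut p q t \<inter> anchored_box d z)) \<partial>ucube d)"
proof -
  define \<psi> where "\<psi> j s = ennreal ((r j)\<^sup>2 * tail (j = p) s)" for j s
  have [measurable]: "\<psi> j \<in> borel_measurable borel" for j unfolding \<psi>_def[abs_def] by measurable
  define K where "K = (\<lambda>t. \<integral>\<^sup>+v. ennreal (tail False v) * ennreal (tail_primitive (- t * v) - tail_primitive (-1)) * indicator {-1..1} v \<partial>lborel)"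
  define R where "R = ennreal ((r q)\<^sup>2) * ennreal ((r p)\<^sup>2)"
  define C where "C = ennreal (r p) * ennreal (r q) *
        (\<Prod>j\<in>{1..d}-{p,q}. ennreal (r j) * (\<integral>\<^sup>+u. \<psi> j u * indicator {-1..1} u \<partial>lborel))"
  have main: "(\<integral>\<^sup>+z. ennreal (straight_profile p z * measure (leb d) (cut p q t \<inter> anchored_box d z)) \<partial>ucube d) = R * K t * C"
    if t: "0 \<le> t" "t \<le> 1" for t
  proof -
    have "(\<integral>\<^sup>+z. ennreal (straight_profile p z * measure (leb d) (cut p q t \<inter> anchored_box d z)) \<partial>ucube d)
      = (\<integral>\<^sup>+x. (\<Prod>j\<in>{1..d}. \<psi> j (rel_coord (r j) (x j))) * indicator (cut p q t) x \<partial>leb d)"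
      unfolding \<psi>_def using pq by (intro nn_integral_straight_profile_mult_measure cut_subset_whole) auto
    also have "\<dots> = (\<integral>\<^sup>+v. \<psi> q v * (\<integral>\<^sup>+u. \<psi> p u * indicator {-1..- t * v} u \<partial>lborel) * indicator {-1..1} v \<partial>lborel) * C"
      unfolding C_def by (rule nn_integral_cut[OF pq t]) measurable
    also have "(\<integral>\<^sup>+v. \<psi> q v * (\<integral>\<^sup>+u. \<psi> p u * indicator {-1..- t * v} u \<partial>lborel) * indicator {-1..1} v \<partial>lborel)
      = (\<integral>\<^sup>+v. R * (ennreal (tail False v) * ennreal (tail_primitive (- t * v) - tail_primitive (-1)) * indicator {-1..1} v) \<partial>lborel)"
    proof (rule nn_integral_cong)
      fix v :: real
      show "\<psi> q v * (\<integral>\<^sup>+u. \<psi> p u * indicator {-1..- t * v} u \<partial>lborel) * indicator {-1..1} v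
        = R * (ennreal (tail False v) * ennreal (tail_primitive (- t * v) - tail_primitive (-1)) * indicator {-1..1} v)"
      proof (cases "v \<in> {-1..1}")
        case True
        have "\<bar>t * v\<bar> \<le> 1" using t True by (auto simp: abs_mult intro!: mult_le_one)
        then have b: "- t * v \<in> {-1..1}" by auto
        have "(\<integral>\<^sup>+u. \<psi> p u * indicator {-1..- t * v} u \<partial>lborel)
          = (\<integral>\<^sup>+u. ennreal ((r p)\<^sup>2) * (ennreal (tail True u) * indicator {-1..- t * v} u) \<partial>lborel)"
          by (intro nn_integral_cong) (simp add: \<psi>_def ennreal_mult' mult.assoc)
        also have "\<dots> = ennreal ((r p)\<^sup>2) * ennreal (tail_primitive (- t * v) - tail_primitive (-1))"
          by (subst nn_integral_cmult) (simp_all only: nn_integral_tail_initial[OF b], measurable)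
        finally have "(\<integral>\<^sup>+u. \<psi> p u * indicator {-1..- t * v} u \<partial>lborel)
          = ennreal ((r p)\<^sup>2) * ennreal (tail_primitive (- t * v) - tail_primitive (-1))" .
        moreover have "\<psi> q v = ennreal ((r q)\<^sup>2) * ennreal (tail False v)"
          using pq by (simp add: \<psi>_def ennreal_mult')
        ultimately show ?thesis by (simp only: R_def ac_simps)
      qed simp
    qed
    also have "\<dots> = R * K t"
      unfolding K_def by (rule nn_integral_cmult) measurable
    finally show ?thesis .
  qed
  have "K 0 \<le> K t" unfolding K_def by (rule tail_integral_slanted_ge_straight[OF t])
  then show ?thesis
    using t by (simp add: main mult_left_mono mult_right_mono)
qed

text \<open>
  Volume of the first part below \<open>z\<close> minus volume of the second part below \<open>z\<close>, with the second volume
  written as the difference of the whole and the first.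
\<close>

definition imbalance :: "nat \<Rightarrow> nat \<Rightarrow> real \<Rightarrow> (nat \<Rightarrow> real) \<Rightarrow> real" where
  "imbalance p q t z = 2 * measure (leb d) (cut p q t \<inter> anchored_box d z) - measure (leb d) (whole \<inter> anchored_box d z)"

lemma measure_Int_box_le:
  assumes "A \<in> sets (leb d)" "A \<subseteq> whole"
  shows "measure (leb d) (A \<inter> anchored_box d z) \<le> measure (leb d) whole"
proof (rule measure_mono_fmeasurable)
  show "whole \<in> fmeasurable (leb d)" using finite_subset_whole[of whole] by (auto simp: fmeasurable_def)
qed (use assms in auto)

text \<open>
  Expanding the square around the straight cut and dropping the nonnegative quadratic remainder leaves
  a cross term that is linear in the measure of the cut.
\<close>

lemma
  assumes pq: "p \<in> {1..d}" "q \<in> {1..d}" "p \<noteq> q" and t: "0 \<le> t" "t \<le> 1"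
  shows integrable_imbalance_square: "integrable (ucube d) (\<lambda>z. (imbalance p q t z)\<^sup>2)"
    and integral_imbalance_square_ge_straight: "(LINT z|ucube d. (imbalance p q 0 z)\<^sup>2) \<le> (LINT z|ucube d. (imbalance p q t z)\<^sup>2)"
proof -
  define c where "c = measure (leb d) whole"
  define \<mu> where "\<mu> t z = measure (leb d) (cut p q t \<inter> anchored_box d z)" for t z
  have [measurable]: "\<mu> t \<in> borel_measurable (leb d)" for t
    unfolding \<mu>_def[abs_def] using pq cut_subset_whole finite_subset_whole
    by (intro measurable_measure_Int_anchored_box) auto
  have [measurable]: "(\<lambda>z. measure (leb d) (whole \<inter> anchored_box d z)) \<in> borel_measurable (leb d)"
    using finite_subset_whole by (intro measurable_measure_Int_anchored_box) auto
  have [measurable]: "imbalance p q t \<in> borel_measurable (leb d)" for t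
    unfolding imbalance_def[abs_def] \<mu>_def[symmetric] by measurable
  have \<mu>_bd: "0 \<le> \<mu> t z" "\<mu> t z \<le> c" for t z
    unfolding \<mu>_def c_def using pq by (auto intro!: measure_Int_box_le cut_subset_whole)
  have bd: "\<bar>imbalance p q t z\<bar> \<le> 2 * c" for t z
    using \<mu>_bd[of t z] measure_Int_box_le[OF sets_whole subset_refl, of z] measure_nonneg[of "leb d" "whole \<inter> anchored_box d z"]
    unfolding imbalance_def \<mu>_def[symmetric] c_def[symmetric] abs_le_iff by (intro conjI) linarith+
  have c0: "0 \<le> c" by (simp add: c_def)
  have i1: "integrable (ucube d) (\<lambda>z. (imbalance p q t z)\<^sup>2)" for t
  proof (rule integrable_ucube[where B = "(2 * c)\<^sup>2"])
    fix z show "\<bar>(imbalance p q t z)\<^sup>2\<bar> \<le> (2 * c)\<^sup>2"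
      using bd[of t z] c0 abs_le_square_iff[of "imbalance p q t z" "2 * c"] by simp
  qed measurable
  have i2: "integrable (ucube d) (\<lambda>z. imbalance p q 0 z * \<mu> t z)" for t
  proof (rule integrable_ucube[where B = "2 * c * c"])
    fix z show "\<bar>imbalance p q 0 z * \<mu> t z\<bar> \<le> 2 * c * c"
      using bd[of 0 z] \<mu>_bd[of t z] c0 by (auto simp: abs_mult intro!: mult_mono)
  qed measurable
  have ref: "imbalance p q 0 z = straight_profile p z" if "z \<in> unit_cube d" for z
    unfolding imbalance_def using imbalance_straight_cut[OF that pq(1)] .
  have nn: "0 \<le> imbalance p q 0 z * \<mu> t z" if "z \<in> unit_cube d" for z t
    using ref[OF that] straight_profile_nonneg \<mu>_bd by simp
  have "ennreal (LINT z|ucube d. imbalance p q 0 z * \<mu> s z) = (\<integral>\<^sup>+z. ennreal (straight_profile p z * \<mu> s z) \<partial>ucube d)" for s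
    using i2 nn by (subst nn_integral_eq_integral[symmetric])
      (auto simp: space_ucube ref intro!: AE_I2 nn_integral_cong)
  with nn_integral_straight_profile_cut_mono[OF assms]
  have "ennreal (LINT z|ucube d. imbalance p q 0 z * \<mu> 0 z) \<le> ennreal (LINT z|ucube d. imbalance p q 0 z * \<mu> t z)"
    by (simp add: \<mu>_def)
  moreover have "0 \<le> (LINT z|ucube d. imbalance p q 0 z * \<mu> t z)"
    using nn by (intro integral_nonneg_AE AE_I2) (auto simp: space_ucube)
  ultimately have cross: "(LINT z|ucube d. imbalance p q 0 z * \<mu> 0 z) \<le> (LINT z|ucube d. imbalance p q 0 z * \<mu> t z)"
    by simp
  have "(LINT z|ucube d. (imbalance p q 0 z)\<^sup>2)
     \<le> (LINT z|ucube d. (imbalance p q 0 z)\<^sup>2) + 4 * ((LINT z|ucube d. imbalance p q 0 z * \<mu> t z) - (LINT z|ucube d. imbalance p q 0 z * \<mu> 0 z))"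
    using cross by simp
  also have "\<dots> = (LINT z|ucube d. (imbalance p q 0 z)\<^sup>2 + 4 * (imbalance p q 0 z * \<mu> t z - imbalance p q 0 z * \<mu> 0 z))"
    using i1 i2 by simp
  also have "\<dots> \<le> (LINT z|ucube d. (imbalance p q t z)\<^sup>2)"
  proof (rule integral_mono)
    fix z
    have "imbalance p q t z = imbalance p q 0 z + 2 * (\<mu> t z - \<mu> 0 z)" by (simp add: imbalance_def \<mu>_def)
    then have "(imbalance p q t z)\<^sup>2 = (imbalance p q 0 z)\<^sup>2 + 4 * (imbalance p q 0 z * \<mu> t z - imbalance p q 0 z * \<mu> 0 z)
        + (2 * (\<mu> t z - \<mu> 0 z))\<^sup>2"
      by algebra
    then show "(imbalance p q 0 z)\<^sup>2 + 4 * (imbalance p q 0 z * \<mu> t z - imbalance p q 0 z * \<mu> 0 z) \<le> (imbalance p q t z)\<^sup>2"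
      by simp
  qed (use i1 i2 in auto)
  finally show "(LINT z|ucube d. (imbalance p q 0 z)\<^sup>2) \<le> (LINT z|ucube d. (imbalance p q t z)\<^sup>2)" .
  show "integrable (ucube d) (\<lambda>z. (imbalance p q t z)\<^sup>2)" by (rule i1)
qed

lemma integral_imbalance_square_straight:
  assumes "p \<in> {1..d}"
  shows "(LINT z|ucube d. (imbalance p q 0 z)\<^sup>2) = (\<Prod>j\<in>{1..d}. r j ^ 3) * ((2/3) * (8/3) ^ (d - 1))"
proof -
  have "(LINT z|ucube d. (imbalance p q 0 z)\<^sup>2) = (LINT z|ucube d. (straight_profile p z)\<^sup>2)"
    by (rule Bochner_Integration.integral_cong[OF refl])
       (simp add: imbalance_def imbalance_straight_cut[OF _ assms] space_ucube)
  then show ?thesis using integral_straight_profile_square[OF assms] by simp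
qed

text \<open>
  The mean square error depends on the cut only through the squared imbalance, and decreases with it.
\<close>

lemma mean_square_error_eq:
  assumes pq: "p \<in> {1..d}" "q \<in> {1..d}" "p \<noteq> q" and t: "0 \<le> t" "t \<le> 1"
    and N: "N \<ge> 2" and Q: "Q 1 = cut p q t" "Q 2 = cocut p q t"
  defines "S \<equiv> \<lambda>z. measure (leb d) (whole \<inter> anchored_box d z) / (vol / 2)"
  shows "mean_square_error d N Q z =
     (measure (leb d) (anchored_box d z) - 1 / real N * (S z + (\<Sum>i=3..N. hit_prob d (Q i) z)))\<^sup>2
     + (1 / real N)\<^sup>2 * (S z - (S z)\<^sup>2 / 2 + (\<Sum>i=3..N. hit_prob d (Q i) z - (hit_prob d (Q i) z)\<^sup>2))
     - 2 / (real N * vol)\<^sup>2 * (imbalance p q t z)\<^sup>2"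
proof -
  have split: "(\<Sum>i=1..N. f i) = f 1 + f 2 + (\<Sum>i=3..N. f i)" for f :: "nat \<Rightarrow> real"
  proof -
    have "{1..N} = insert 1 (insert 2 {3..N})" using N by auto
    then show ?thesis by simp
  qed
  define a b where "a = hit_prob d (cut p q t) z" and "b = hit_prob d (cocut p q t) z"
  have sum: "a + b = S z"
    unfolding a_def b_def S_def hit_prob_cut[OF pq t] add_divide_distrib[symmetric]
    by (simp add: cut_cocut_split(2)[OF pq])
  have imbalance: "imbalance p q t z = (vol / 2) * (a - b)"
    unfolding a_def b_def hit_prob_cut[OF pq t] imbalance_def
      cut_cocut_split(2)[OF pq sets_anchored_box, of t z, symmetric]
    using vol_pos by (simp add: field_simps)
  have diff: "2 / (real N * vol)\<^sup>2 * (imbalance p q t z)\<^sup>2 = (1 / real N)\<^sup>2 * ((a - b)\<^sup>2 / 2)"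
    unfolding imbalance using vol_pos N by (simp add: field_simps power2_eq_square)
  have eq: "a - a\<^sup>2 + (b - b\<^sup>2) = S z - (S z)\<^sup>2 / 2 - (a - b)\<^sup>2 / 2"
    unfolding sum[symmetric] by (simp add: power2_eq_square field_simps)
  show ?thesis
    unfolding mean_square_error_def split Q a_def[symmetric] b_def[symmetric] sum diff eq
    by (simp add: algebra_simps)
qed

end

section \<open>The two partitions\<close>

text \<open>
  In rescaled coordinates the cutting line is \<open>2 sin \<theta> x\<^sub>1 + cos \<theta> x\<^sub>2 = 0\<close>, the factor \<open>2\<close> being the aspect
  ratio of the rectangle. Dividing by the larger of the two coefficients gives a slope \<open>t \<le> 1\<close>.
\<close>

lemma local_partition_cuts:
  fixes d m :: nat
  assumes d: "d \<ge> 2" and m: "m \<ge> 2"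
  defines "r \<equiv> \<lambda>j. if j = 1 then side m else side m / 2"
  shows "corner_cuboid d r" and "cuboid d m = corner_cuboid.whole d r"
    and "grid1 d m = corner_cuboid.cut d r 1 2 0" and "grid2 d m = corner_cuboid.cocut d r 1 2 0"
    and "0 \<le> \<theta> \<Longrightarrow> \<theta> \<le> pi / 2 \<Longrightarrow> \<exists>p q t. p \<in> {1..d} \<and> q \<in> {1..d} \<and> p \<noteq> q \<and> 0 \<le> t \<and> t \<le> 1 \<and>
       local1 d m \<theta> = corner_cuboid.cut d r p q t \<and> local2 d m \<theta> = corner_cuboid.cocut d r p q t"
proof -
  have b: "0 < side m" "2 * side m \<le> 1" using m by (auto simp: side_def field_simps)
  show cb: "corner_cuboid d r" by standard (use b in \<open>auto simp: r_def\<close>)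
  interpret corner_cuboid d r by (rule cb)
  have c1: "corner m 1 = 1 - 2 * side m" and c: "\<And>j. j \<noteq> 1 \<Longrightarrow> corner m j = 1 - side m"
    using m by (auto simp: corner_def side_def field_simps)
  show cub: "cuboid d m = whole"
    unfolding cuboid_def whole_def by (intro PiE_cong) (auto simp: c1 c r_def)
  have r1: "r 1 = side m" and r2: "r 2 = side m / 2" by (auto simp: r_def)
  have n1: "rel_coord (r 1) y = (y - corner m 1 - side m) / side m" for y
    using b by (simp add: rel_coord_def r1 c1 field_simps)
  have n2: "rel_coord (r 2) y = (y - corner m 2 - side m / 2) / (side m / 2)" for y
    using b by (simp add: rel_coord_def r2 c field_simps)
  have D: "1 \<in> {1..d}" "2 \<in> {1..d}" using d by auto
  have one_neq_two: "(1::nat) \<noteq> 2" "(2::nat) \<noteq> 1" by simp_all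
  have side_iff: "rel_coord (r 1) y \<le> 0 \<longleftrightarrow> y \<le> 1 - side m" "0 \<le> rel_coord (r 1) y \<longleftrightarrow> 1 - side m \<le> y" for y
    using b by (auto simp: rel_coord_def r1 field_simps)
  show "grid1 d m = cut 1 2 0"
  proof (rule set_eqI)
    fix x
    have "x j \<in> {corner m j..corner m j + side m} \<longleftrightarrow> x j \<in> {1 - 2 * r j..1} \<and> (j = 1 \<longrightarrow> x 1 \<le> 1 - side m)" for j
      using b by (auto simp: c1 c r_def)
    then show "x \<in> grid1 d m \<longleftrightarrow> x \<in> cut 1 2 0"
      using D unfolding grid1_def cut_def whole_def PiE_iff by (auto simp: side_iff)
  qed
  show "grid2 d m = cocut 1 2 0"
  proof (rule set_eqI)
    fix x
    have "x j \<in> (if j = 1 then {corner m 1 + side m..corner m 1 + 2 * side m} else {corner m j..corner m j + side m})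
       \<longleftrightarrow> x j \<in> {1 - 2 * r j..1} \<and> (j = 1 \<longrightarrow> 1 - side m \<le> x 1)" for j
      using b by (auto simp: c1 c r_def)
    then show "x \<in> grid2 d m \<longleftrightarrow> x \<in> cocut 1 2 0"
      using D unfolding grid2_def cocut_def whole_def PiE_iff by (auto simp: side_iff)
  qed
  assume th: "0 \<le> \<theta>" "\<theta> \<le> pi / 2"
  have s0: "0 \<le> sin \<theta>" and c0: "0 \<le> cos \<theta>"
    using th by (auto intro!: sin_ge_zero cos_ge_zero)
  have sc: "sin \<theta> \<noteq> 0 \<or> cos \<theta> \<noteq> 0" using sin_zero_norm_cos_one[of \<theta>] by auto
  have l1: "local1 d m \<theta> = {x \<in> whole. 2 * sin \<theta> * rel_coord (r 1) (x 1) + cos \<theta> * rel_coord (r 2) (x 2) \<le> 0}"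
  proof -
    have eq: "(y - corner m 1 - side m) * sin \<theta> + (z - corner m 2 - side m / 2) * cos \<theta>
       = side m / 2 * (2 * sin \<theta> * rel_coord (r 1) y + cos \<theta> * rel_coord (r 2) z)" for y z
      using b by (simp add: n1 n2 field_simps)
    show ?thesis
      unfolding local1_def cub eq using b by (simp add: mult_le_0_iff)
  qed
  have "\<exists>p q t. p \<in> {1..d} \<and> q \<in> {1..d} \<and> p \<noteq> q \<and> 0 \<le> t \<and> t \<le> 1 \<and> local1 d m \<theta> = cut p q t"
  proof (cases "cos \<theta> \<le> 2 * sin \<theta>")
    case True
    then have s: "0 < sin \<theta>" using s0 c0 sc by linarith
    have "local1 d m \<theta> = cut 1 2 (cos \<theta> / (2 * sin \<theta>))"
      unfolding l1 cut_def using s by (auto simp: field_simps)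
    moreover have "0 \<le> cos \<theta> / (2 * sin \<theta>)" "cos \<theta> / (2 * sin \<theta>) \<le> 1"
      using True s c0 by simp_all
    ultimately show ?thesis using D one_neq_two by blast
  next
    case False
    then have c: "0 < cos \<theta>" using s0 by linarith
    have "local1 d m \<theta> = cut 2 1 (2 * sin \<theta> / cos \<theta>)"
      unfolding l1 cut_def using c by (auto simp: field_simps)
    moreover have "0 \<le> 2 * sin \<theta> / cos \<theta>" "2 * sin \<theta> / cos \<theta> \<le> 1"
      using False c s0 by simp_all
    ultimately show ?thesis using D one_neq_two by blast
  qed
  then show "\<exists>p q t. p \<in> {1..d} \<and> q \<in> {1..d} \<and> p \<noteq> q \<and> 0 \<le> t \<and> t \<le> 1 \<and>
       local1 d m \<theta> = cut p q t \<and> local2 d m \<theta> = cocut p q t"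
    unfolding local2_def cub using closure_whole_diff_cut by metis
qed

theorem theorem3p1:
  fixes m d N :: nat and \<theta> :: real
    and Q :: "nat \<Rightarrow> (nat \<Rightarrow> real) set"
    and M :: "'a measure" and X :: "nat \<Rightarrow> 'a \<Rightarrow> nat \<Rightarrow> real"
    and M' :: "'b measure" and Y :: "nat \<Rightarrow> 'b \<Rightarrow> nat \<Rightarrow> real"
  assumes "m \<ge> d" and "d \<ge> 2"
    and "0 \<le> \<theta>" and "\<theta> \<le> pi / 2"
    and "N = m ^ d"
    and "grid_partition d m Q"
    and "stratified d N Q M X"
    and "stratified d N (local_partition d m \<theta> Q) M' Y"
  shows "prob_space.expectation M' (\<lambda>\<omega>. (L2_disc d N (\<lambda>i. Y i \<omega>))\<^sup>2)
       \<le> prob_space.expectation M (\<lambda>\<omega>. (L2_disc d N (\<lambda>i. X i \<omega>))\<^sup>2)"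
proof -
  define r where "r j = (if j = 1 then side m else side m / 2)" for j :: nat
  have m: "m \<ge> 2" using assms by simp
  note geom = local_partition_cuts[OF \<open>d \<ge> 2\<close> m, folded r_def]
  interpret corner_cuboid d r by (rule geom(1))
  obtain p q t where pq: "p \<in> {1..d}" "q \<in> {1..d}" "p \<noteq> q" and t: "0 \<le> t" "t \<le> 1"
    and loc: "local1 d m \<theta> = cut p q t" "local2 d m \<theta> = cocut p q t"
    using geom(5)[OF assms(3,4)] by blast
  have D: "1 \<in> {1..d}" "2 \<in> {1..d}" "1 \<noteq> (2::nat)" using \<open>d \<ge> 2\<close> by auto
  have N: "N \<ge> 2"
    using \<open>d \<ge> 2\<close> m self_le_power[of m d] by (simp add: \<open>N = m ^ d\<close>)
  let ?Q' = "local_partition d m \<theta> Q"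
  have Q: "Q 1 = cut 1 2 0" "Q 2 = cocut 1 2 0"
    using \<open>grid_partition d m Q\<close> geom(3,4) by (auto simp: grid_partition_def)
  have Q': "?Q' 1 = cut p q t" "?Q' 2 = cocut p q t"
    by (simp_all add: local_partition_def loc)
  have same: "(\<Sum>i=3..N. f (?Q' i)) = (\<Sum>i=3..N. f (Q i))" for f :: "(nat \<Rightarrow> real) set \<Rightarrow> real"
    by (intro sum.cong) (auto simp: local_partition_def)
  \<comment> \<open>The weight of the squared imbalance in the mean square error.\<close>
  define k where "k = 2 / (real N * vol)\<^sup>2"
  have eq: "mean_square_error d N ?Q' z = mean_square_error d N Q z + k * ((imbalance 1 2 0 z)\<^sup>2 - (imbalance p q t z)\<^sup>2)" for z
    unfolding mean_square_error_eq[OF pq t N Q'] mean_square_error_eq[OF D order.refl zero_le_one N Q]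
      same[of "\<lambda>A. hit_prob d A z"] same[of "\<lambda>A. hit_prob d A z - (hit_prob d A z)\<^sup>2"] k_def
    by (simp add: right_diff_distrib)
  have i: "integrable (ucube d) (\<lambda>z. (imbalance 1 2 0 z)\<^sup>2)" "integrable (ucube d) (\<lambda>z. (imbalance p q t z)\<^sup>2)"
    using integrable_imbalance_square[OF D, of 0] integrable_imbalance_square[OF pq t] by auto
  \<comment> \<open>The vertical cut has the same norm as the straight cut in the direction \<open>p\<close> of the given line.\<close>
  have "(LINT z|ucube d. (imbalance 1 2 0 z)\<^sup>2) = (LINT z|ucube d. (imbalance p q 0 z)\<^sup>2)"
    by (simp only: integral_imbalance_square_straight[OF D(1)] integral_imbalance_square_straight[OF pq(1)])
  also have "\<dots> \<le> (LINT z|ucube d. (imbalance p q t z)\<^sup>2)"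
    by (rule integral_imbalance_square_ge_straight[OF pq t])
  finally have "k * ((LINT z|ucube d. (imbalance 1 2 0 z)\<^sup>2) - (LINT z|ucube d. (imbalance p q t z)\<^sup>2)) \<le> 0"
    by (intro mult_nonneg_nonpos) (auto simp: k_def)
  moreover have "(LINT z|ucube d. mean_square_error d N ?Q' z) = (LINT z|ucube d. mean_square_error d N Q z)
      + k * ((LINT z|ucube d. (imbalance 1 2 0 z)\<^sup>2) - (LINT z|ucube d. (imbalance p q t z)\<^sup>2))"
    unfolding eq using i integrable_mean_square_error[OF assms(7)] by simp
  ultimately show ?thesis
    unfolding expectation_L2_disc[OF assms(7)] expectation_L2_disc[OF assms(8)] by linarith
qed

end
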